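(* Let $M$ be a random measure on a Polish space $\mathbb S$ and let $\mathcal I$ be a countable semi-ring of bounded Borel subsets of $\mathbb S$ which generates the Borel $\sigma$-field $\mathcal S$ and is dissecting, i.e. every open subset of $\mathbb S$ is a countable union of sets in $\mathcal I$ and every bounded Borel set is covered by finitely many sets in $\mathcal I$. Then $M$ is negatively associated (as a random measure) if and only if the random vector $(M(B_1),\dots,M(B_n))$ is negatively associated for all $n\ge1$ and all pairwise disjoint $B_1,\dots,B_n\in\mathcal I$. Likewise, $M$ is positively associated if and only if $(M(B_1),\dots,M(B_n))$ is positively associated for all $n\ge1$ and all pairwise disjoint $B_1,\dots,B_n\in\mathcal I$.
   Context: $\mathbb S$ is a Polish space with Borel $\sigma$-field $\mathcal S$, equipped with a fixed complete metric; "bounded" refers to this metric and $\mathcal S_b$ denotes the bounded Borel sets. $\mathbf M(\mathbb S)$ is the space of measures on $\mathbb S$ that are finite on bounded Borel sets, with the $\sigma$-field generated by $\mu\mapsto\mu(B)$, $B\in\mathcal S$, and partial order $\mu<\nu$ iff $\mu(B)\le\nu(B)$ for all $B\in\mathcal S_b$; a function on $\mathbf M(\mathbb S)$ is non-decreasing if it is non-decreasing for $<$. A random measure is a random element of $\mathbf M(\mathbb S)$. For a Borel set $A$, a measurable $f:\mathbf M(\mathbb S)\to\mathbb R$ is measurable with respect to $A$ if it is measurable w.r.t. the $\sigma$-field generated by $\mu\mapsto\mu(B)$, $B\subset A$ Borel (equivalently $f(\mu)=f(\mu(\cdot\cap A))$ for all $\mu$). A random measure $M$ is positively associated (PA) if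 $\mathbb E[f(M)g(M)]\ge\mathbb E[f(M)]\mathbb E[g(M)]$ for all bounded measurable non-decreasing $f,g$ on $\mathbf M(\mathbb S)$; it is negatively associated (NA) if $\mathbb E[f(M)g(M)]\le\mathbb E[f(M)]\mathbb E[g(M)]$ for all bounded measurable non-decreasing $f,g$ that are measurable with respect to disjoint Borel subsets $A,B$ of $\mathbb S$ respectively. A random vector $(Y_1,\dots,Y_n)$ in $\mathbb R^n$ is NA if $\mathbb E[f(Y_J)g(Y_{J^c})]\le\mathbb E[f(Y_J)]\mathbb E[g(Y_{J^c})]$ for all $J\subset\{1,\dots,n\}$ and bounded measurable coordinatewise non-decreasing $f,g$, and PA if $\mathbb E[f(Y_J)g(Y_J)]\ge\mathbb E[f(Y_J)]\mathbb E[g(Y_J)]$ for all $J$ and all such $f,g$ on $\mathbb R^J$. *)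

theory Defs
  imports "HOL-Probability.Probability"
begin

definition Mspace :: "'a::metric_space measure set" where
  "Mspace = {\<mu>. sets \<mu> = sets borel \<and>
      (\<forall>B\<in>sets borel. bounded B \<longrightarrow> emeasure \<mu> B < \<infinity>)}"

definition Mmeas_on :: "'a::metric_space set \<Rightarrow> 'a measure measure" where
  "Mmeas_on A = sigma Mspace
     {{\<mu>\<in>Mspace. emeasure \<mu> B \<in> X} | B X. B \<in> sets borel \<and> B \<subseteq> A \<and> X \<in> sets (borel :: ennreal measure)}"

definition Mmeas :: "'a::metric_space measure measure" where
  "Mmeas = Mmeas_on UNIV"

definition meas_le :: "'a::metric_space measure \<Rightarrow> 'a measure \<Rightarrow> bool" where
  "meas_le \<mu> \<nu> \<longleftrightarrow> (\<forall>B\<in>sets borel. bounded B \<longrightarrow> emeasure \<mu> B \<le> emeasure \<nu> B)"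

definition incr_bdd_M :: "('a::metric_space measure \<Rightarrow> real) \<Rightarrow> bool" where
  "incr_bdd_M f \<longleftrightarrow> f \<in> borel_measurable Mmeas \<and>
     (\<exists>C. \<forall>\<mu>\<in>Mspace. \<bar>f \<mu>\<bar> \<le> C) \<and>
     (\<forall>\<mu>\<in>Mspace. \<forall>\<nu>\<in>Mspace. meas_le \<mu> \<nu> \<longrightarrow> f \<mu> \<le> f \<nu>)"

definition random_measure :: "'w measure \<Rightarrow> ('w \<Rightarrow> 'a::metric_space measure) \<Rightarrow> bool" where
  "random_measure P M \<longleftrightarrow> prob_space P \<and> M \<in> measurable P Mmeas"

definition PA_rm :: "'w measure \<Rightarrow> ('w \<Rightarrow> 'a::metric_space measure) \<Rightarrow> bool" where
  "PA_rm P M \<longleftrightarrow> (\<forall>f g. incr_bdd_M f \<longrightarrow> incr_bdd_M g \<longrightarrow>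
     (\<integral>\<omega>. f (M \<omega>) * g (M \<omega>) \<partial>P) \<ge> (\<integral>\<omega>. f (M \<omega>) \<partial>P) * (\<integral>\<omega>. g (M \<omega>) \<partial>P))"

definition NA_rm :: "'w measure \<Rightarrow> ('w \<Rightarrow> 'a::metric_space measure) \<Rightarrow> bool" where
  "NA_rm P M \<longleftrightarrow> (\<forall>A B f g. A \<in> sets borel \<longrightarrow> B \<in> sets borel \<longrightarrow> A \<inter> B = {} \<longrightarrow>
     incr_bdd_M f \<longrightarrow> incr_bdd_M g \<longrightarrow>
     f \<in> borel_measurable (Mmeas_on A) \<longrightarrow> g \<in> borel_measurable (Mmeas_on B) \<longrightarrow>
     (\<integral>\<omega>. f (M \<omega>) * g (M \<omega>) \<partial>P) \<le> (\<integral>\<omega>. f (M \<omega>) \<partial>P) * (\<integral>\<omega>. g (M \<omega>) \<partial>P))"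

definition incr_bdd_vec :: "nat set \<Rightarrow> ((nat \<Rightarrow> real) \<Rightarrow> real) \<Rightarrow> bool" where
  "incr_bdd_vec J f \<longleftrightarrow> f \<in> borel_measurable (PiM J (\<lambda>_. borel)) \<and>
     (\<exists>C. \<forall>x\<in>space (PiM J (\<lambda>_. borel)). \<bar>f x\<bar> \<le> C) \<and>
     (\<forall>x\<in>space (PiM J (\<lambda>_. borel)). \<forall>y\<in>space (PiM J (\<lambda>_. borel)).
         (\<forall>j\<in>J. x j \<le> y j) \<longrightarrow> f x \<le> f y)"

definition NA_vec :: "'w measure \<Rightarrow> nat \<Rightarrow> (nat \<Rightarrow> 'w \<Rightarrow> real) \<Rightarrow> bool" where
  "NA_vec P n Y \<longleftrightarrow> (\<forall>J f g. J \<subseteq> {..<n} \<longrightarrow> incr_bdd_vec J f \<longrightarrow> incr_bdd_vec ({..<n} - J) g \<longrightarrow>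
     (\<integral>\<omega>. f (\<lambda>j\<in>J. Y j \<omega>) * g (\<lambda>j\<in>{..<n} - J. Y j \<omega>) \<partial>P)
       \<le> (\<integral>\<omega>. f (\<lambda>j\<in>J. Y j \<omega>) \<partial>P) * (\<integral>\<omega>. g (\<lambda>j\<in>{..<n} - J. Y j \<omega>) \<partial>P))"

definition PA_vec :: "'w measure \<Rightarrow> nat \<Rightarrow> (nat \<Rightarrow> 'w \<Rightarrow> real) \<Rightarrow> bool" where
  "PA_vec P n Y \<longleftrightarrow> (\<forall>J f g. J \<subseteq> {..<n} \<longrightarrow> incr_bdd_vec J f \<longrightarrow> incr_bdd_vec J g \<longrightarrow>
     (\<integral>\<omega>. f (\<lambda>j\<in>J. Y j \<omega>) * g (\<lambda>j\<in>J. Y j \<omega>) \<partial>P)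
       \<ge> (\<integral>\<omega>. f (\<lambda>j\<in>J. Y j \<omega>) \<partial>P) * (\<integral>\<omega>. g (\<lambda>j\<in>J. Y j \<omega>) \<partial>P))"

definition dissecting :: "'a::metric_space set set \<Rightarrow> bool" where
  "dissecting I \<longleftrightarrow>
     (\<forall>U. open U \<longrightarrow> (\<exists>C\<subseteq>I. countable C \<and> U = \<Union>C)) \<and>
     (\<forall>B\<in>sets borel. bounded B \<longrightarrow> (\<exists>C\<subseteq>I. finite C \<and> B \<subseteq> \<Union>C))"

end

(* A measure on the union of countably many disjoint compact sets L k, in each of which all members of a
   countable ring of sets are relatively closed, is determined by its values on the sets R \<inter> L k (R in the
   ring); there finite additivity implies countable additivity, so the sequences of values which occur
   form a Borel subset of the Polish space of real sequences.  Such L k exhaust any Borel set A up to a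
   set that M almost surely does not charge.  Under this encoding a level set {f > t} of a non-decreasing
   f that is measurable with respect to A is approximated from inside by a compact set K of sequences.
   The upward closure of K stays inside {f > t} by monotonicity, and its indicator is a limit of Lipschitz
   non-decreasing functions of finitely many coordinates.  So the indicator of {f > t} is approximated in
   L1 by Lipschitz non-decreasing functions of (M(C 1),...,M(C m)) with bounded Borel C i \<subseteq> A.  Replacing
   the C i by ring sets, and these by their disjoint pieces in I, reduces the covariance inequality to the
   one for vectors; a general f is a uniform limit of combinations of indicators of its level sets. *)

theory Submission
  imports Defs
begin

subsection \<open>Locally finite measures and the generated ring\<close>

text \<open>The obstacle is to approximate a non-decreasing function of measures by functions of
  finitely many values without losing monotonicity: monotone class arguments, or conditioning on
  finitely many coordinates, yield approximants that need not be monotone. The upward closure of a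
  compact set restores monotonicity and costs only the mass of the level set outside the compact
  set. That closure is formed among real sequences in the coordinatewise order, so comparing
  coordinates must imply comparing the decoded measures. The pieces lie in A and not merely in the
  whole space, which keeps the evaluation sets of f and g disjoint in the negative case. No M(B) is
  assumed integrable. Hence null sets are detected by a weighted intensity measure and sets are
  compared through E(min 1 (M D)); Lipschitz bounds for functions with values in [0,1] survive this
  truncation. Both equivalences run through the single inequality
  \<open>0 \<le> s * cov X Y\<close>, with s = -1 for negative and s = 1 for positive
  association.\<close>

lemma space_Mmeas_on [simp]: "space (Mmeas_on A) = Mspace"
  unfolding Mmeas_on_def by (rule space_measure_of) auto

lemma space_Mmeas [simp]: "space Mmeas = Mspace"
  by (simp add: Mmeas_def)

lemma sets_Mmeas_on:
  "sets (Mmeas_on A) = sigma_sets Mspace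
     {{\<mu>\<in>Mspace. emeasure \<mu> B \<in> X} | B X. B \<in> sets borel \<and> B \<subseteq> A \<and> X \<in> sets (borel :: ennreal measure)}"
  unfolding Mmeas_on_def by (rule sets_measure_of) auto

lemma Mspace_sets: "\<mu> \<in> Mspace \<Longrightarrow> sets \<mu> = sets borel"
  by (simp add: Mspace_def)

lemma Mspace_finite:
  "\<mu> \<in> Mspace \<Longrightarrow> B \<in> sets borel \<Longrightarrow> bounded B \<Longrightarrow> emeasure \<mu> B < \<infinity>"
  unfolding Mspace_def by blast

lemma Mspace_fmeasurable:
  "\<mu> \<in> Mspace \<Longrightarrow> B \<in> sets borel \<Longrightarrow> bounded B \<Longrightarrow> B \<in> fmeasurable \<mu>"
  using Mspace_finite[of \<mu> B] by (simp add: fmeasurable_def Mspace_sets)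

lemma emeasure_measurable_Mmeas_on:
  assumes "B \<in> sets borel" "B \<subseteq> A"
  shows "(\<lambda>\<mu>. emeasure \<mu> B) \<in> borel_measurable (Mmeas_on A)"
proof (rule measurableI)
  fix X :: "ennreal set" assume "X \<in> sets borel"
  with assms have "{\<mu>\<in>Mspace. emeasure \<mu> B \<in> X} \<in> sets (Mmeas_on A)"
    unfolding sets_Mmeas_on by (intro sigma_sets.Basic) blast
  also have "{\<mu>\<in>Mspace. emeasure \<mu> B \<in> X} = (\<lambda>\<mu>. emeasure \<mu> B) -` X \<inter> space (Mmeas_on A)"
    by auto
  finally show "(\<lambda>\<mu>. emeasure \<mu> B) -` X \<inter> space (Mmeas_on A) \<in> sets (Mmeas_on A)" .
qed simp

lemma measure_measurable_Mmeas_on: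
  "B \<in> sets borel \<Longrightarrow> B \<subseteq> A \<Longrightarrow> (\<lambda>\<mu>. measure \<mu> B) \<in> borel_measurable (Mmeas_on A)"
  unfolding measure_def
  by (rule measurable_compose[OF emeasure_measurable_Mmeas_on]) auto

lemma measurable_into_Mmeas:
  assumes "\<And>x. x \<in> space N \<Longrightarrow> g x \<in> Mspace"
    and "\<And>B. B \<in> sets borel \<Longrightarrow> (\<lambda>x. emeasure (g x) B) \<in> borel_measurable N"
  shows "g \<in> measurable N Mmeas"
  unfolding Mmeas_def Mmeas_on_def
proof (rule measurable_measure_of)
  fix Y assume "Y \<in> {{\<mu> \<in> Mspace. emeasure \<mu> B \<in> X} |B X.
               B \<in> sets borel \<and> B \<subseteq> (UNIV :: 'b set) \<and> X \<in> sets (borel :: ennreal measure)}"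
  then obtain B X where Y: "Y = {\<mu> \<in> Mspace. emeasure \<mu> B \<in> X}"
    "B \<in> sets borel" "X \<in> sets (borel :: ennreal measure)" by blast
  have "g -` Y \<inter> space N = (\<lambda>x. emeasure (g x) B) -` X \<inter> space N"
    using assms(1) by (auto simp: Y(1))
  also have "\<dots> \<in> sets N" using assms(2)[OF Y(2)] Y(3) by (rule measurable_sets)
  finally show "g -` Y \<inter> space N \<in> sets N" .
qed (use assms in auto)

text \<open>Each generator of \<open>Mmeas_on A\<close>, hence each set in it, contains both
  measures or neither; this is applied to the preimage of the value \<open>f \<mu>\<close>. It
  allows the random measure to be replaced by one that agrees with it inside A.\<close>

lemma Mmeas_on_cong:
  assumes f: "f \<in> borel_measurable (Mmeas_on A)" and mu: "\<mu> \<in> Mspace" "\<nu> \<in> Mspace"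
    and eq: "\<And>B. B \<in> sets borel \<Longrightarrow> B \<subseteq> A \<Longrightarrow> emeasure \<mu> B = emeasure \<nu> B"
  shows "f \<mu> = (f \<nu> :: real)"
proof -
  have iff: "\<mu> \<in> U \<longleftrightarrow> \<nu> \<in> U" if "U \<in> sets (Mmeas_on A)" for U
    using that unfolding sets_Mmeas_on
  proof (induction rule: sigma_sets.induct)
    case (Basic a)
    then show ?case using mu eq by auto
  qed (use mu in auto)
  have "f -` {f \<mu>} \<inter> space (Mmeas_on A) \<in> sets (Mmeas_on A)"
    using f by (rule measurable_sets) auto
  from iff[OF this] mu show ?thesis by auto
qed

section \<open>The countable ring generated by a dissecting semi-ring\<close>

locale dissecting_semiring = semiring_of_sets UNIV I for I :: "'a::polish_space set set" +
  assumes cnt: "countable I"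
    and bdd: "\<And>B. B \<in> I \<Longrightarrow> B \<in> sets borel \<and> bounded B"
    and gen: "sigma_sets UNIV I = sets borel"
    and diss: "dissecting I"
begin

sublocale ring: ring_of_sets UNIV generated_ring
  by (rule generating_ring)

lemma ring_bdd: "R \<in> generated_ring \<Longrightarrow> R \<in> sets borel \<and> bounded R"
proof (elim generated_ringE)
  fix C assume "finite C" "C \<subseteq> I" "R = \<Union>C"
  then show ?thesis using bdd by (auto intro!: sets.finite_Union)
qed

lemmas ring_borel = ring_bdd[THEN conjunct1]
lemmas ring_bounded = ring_bdd[THEN conjunct2]

lemma countable_ring: "countable generated_ring"
proof -
  have "generated_ring \<subseteq> Union ` {C. finite C \<and> C \<subseteq> I}"
    by (auto elim!: generated_ringE)
  moreover have "countable (Union ` {C. finite C \<and> C \<subseteq> I})"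
    by (intro countable_image countable_Collect_finite_subset cnt)
  ultimately show ?thesis by (rule countable_subset)
qed

lemma sigma_ring: "sigma_sets UNIV generated_ring = sets borel"
  by (simp add: sigma_sets_generated_ring_eq gen)

lemma bounded_in_ring:
  assumes "B \<in> sets borel" "bounded B"
  obtains R where "R \<in> generated_ring" "B \<subseteq> R"
proof -
  have "\<forall>B\<in>sets borel. bounded B \<longrightarrow> (\<exists>C\<subseteq>I. finite C \<and> B \<subseteq> \<Union>C)"
    using diss by (simp add: dissecting_def)
  then obtain C where "C \<subseteq> I" "finite C" "B \<subseteq> \<Union>C"
    using assms by meson
  then show thesis
    using generated_ringI_Basic by (intro that[of "\<Union>C"] ring.finite_Union) auto
qed

text \<open>An increasing exhaustion by ring sets. Every measure in \<open>Mspace\<close> is finite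
  on each of them, so subtraction and continuity from above are available after intersecting with
  \<open>exh n\<close>.\<close>

definition exh :: "nat \<Rightarrow> 'a set" where
  "exh n = (\<Union>i<n. from_nat_into generated_ring i)"

lemma from_nat_into_ring: "from_nat_into generated_ring i \<in> generated_ring"
  using generated_ring_empty by (intro from_nat_into) auto

lemma exh_ring: "exh n \<in> generated_ring"
  unfolding exh_def by (rule ring.finite_UN) (auto intro: from_nat_into_ring)

lemma incseq_exh: "incseq exh"
  unfolding exh_def incseq_def by force

lemma UN_exh: "(\<Union>n. exh n) = UNIV"
proof -
  have "x \<in> (\<Union>n. exh n)" for x :: 'a
  proof -
    obtain R where R: "R \<in> generated_ring" "{x} \<subseteq> R" by (rule bounded_in_ring[of "{x}"]) auto
    then have "x \<in> exh (Suc (to_nat_on generated_ring R))"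
      unfolding exh_def using from_nat_into_to_nat_on[OF countable_ring R(1)] by force
    then show ?thesis by blast
  qed
  then show ?thesis by auto
qed

lemma emeasure_SUP_exh:
  assumes "\<mu> \<in> Mspace" "B \<in> sets borel"
  shows "emeasure \<mu> B = (SUP n. emeasure \<mu> (B \<inter> exh n))"
proof -
  have "(SUP n. emeasure \<mu> (B \<inter> exh n)) = emeasure \<mu> (\<Union>n. B \<inter> exh n)"
    using assms ring_borel[OF exh_ring] incseq_exh
    by (intro SUP_emeasure_incseq) (auto simp: Mspace_sets incseq_def)
  also have "(\<Union>n. B \<inter> exh n) = B" using UN_exh by auto
  finally show ?thesis by simp
qed

text \<open>A Dynkin class argument from the intersection-stable ring. It is run on
  \<open>B \<inter> exh n\<close>, since the complement step subtracts values and needs them finite;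
  letting n grow gives B itself.\<close>

lemma measurable_into_Mmeas_ring:
  fixes g :: "'b \<Rightarrow> 'a measure"
  assumes g: "\<And>x. x \<in> space N \<Longrightarrow> g x \<in> Mspace"
    and meas: "\<And>R. R \<in> generated_ring \<Longrightarrow> (\<lambda>x. emeasure (g x) R) \<in> borel_measurable N"
  shows "g \<in> measurable N Mmeas"
proof (rule measurable_into_Mmeas[OF g])
  fix B :: "'a set" assume B: "B \<in> sets borel"
  have stable: "Int_stable generated_ring" by (auto simp: Int_stable_def)
  have "(\<lambda>x. emeasure (g x) (B \<inter> exh n)) \<in> borel_measurable N" for n
    using stable ring.space_closed B[folded sigma_ring]
  proof (induction B rule: sigma_sets_induct_disjoint)
    case (basic A)
    then show ?case by (intro meas ring.Int exh_ring)
  next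
    case (compl A)
    have "(\<lambda>x. emeasure (g x) (exh n) - emeasure (g x) (A \<inter> exh n)) \<in> borel_measurable N"
      using compl meas[OF exh_ring] by measurable
    also have "?this \<longleftrightarrow> ?case"
    proof (rule measurable_cong)
      fix x assume "x \<in> space N"
      note gx = g[OF this]
      have "(UNIV - A) \<inter> exh n = exh n - (A \<inter> exh n)" by auto
      moreover have "emeasure (g x) (exh n - (A \<inter> exh n)) =
          emeasure (g x) (exh n) - emeasure (g x) (A \<inter> exh n)"
      proof (rule emeasure_Diff)
        have "A \<inter> exh n \<in> sets borel" "bounded (A \<inter> exh n)"
          using compl(1) ring_bdd[OF exh_ring[of n]] by (auto simp: sigma_ring)
        from Mspace_finite[OF gx this] show "emeasure (g x) (A \<inter> exh n) \<noteq> \<infinity>" by simp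
      qed (use compl(1) ring_bdd[OF exh_ring[of n]] in \<open>auto simp: sigma_ring Mspace_sets[OF gx]\<close>)
      ultimately show "emeasure (g x) (exh n) - emeasure (g x) (A \<inter> exh n)
          = emeasure (g x) ((UNIV - A) \<inter> exh n)" by simp
    qed
    finally show ?case .
  next
    case (union A)
    have "(\<lambda>x. \<Sum>i. emeasure (g x) (A i \<inter> exh n)) \<in> borel_measurable N"
      using union(3) by measurable
    also have "?this \<longleftrightarrow> ?case"
    proof (rule measurable_cong)
      fix x assume "x \<in> space N"
      note gx = g[OF this]
      have "(\<Sum>i. emeasure (g x) (A i \<inter> exh n)) = emeasure (g x) (\<Union>i. A i \<inter> exh n)"
        using union(1,2) ring_borel[OF exh_ring[of n]]
        by (intro suminf_emeasure)
          (auto simp: sigma_ring Mspace_sets[OF gx] disjoint_family_on_def)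
      then show "(\<Sum>i. emeasure (g x) (A i \<inter> exh n)) = emeasure (g x) ((\<Union>i. A i) \<inter> exh n)"
        by simp
    qed
    finally show ?case .
  qed simp
  then have "(\<lambda>x. SUP n. emeasure (g x) (B \<inter> exh n)) \<in> borel_measurable N" by measurable
  also have "?this \<longleftrightarrow> (\<lambda>x. emeasure (g x) B) \<in> borel_measurable N"
    using emeasure_SUP_exh[OF g B] by (intro measurable_cong) simp
  finally show "(\<lambda>x. emeasure (g x) B) \<in> borel_measurable N" .
qed

text \<open>The set function \<open>\<rho>\<close> is only required to be a submeasure, so that
  \<open>\<rho> D = E (min 1 (M D))\<close> is allowed.\<close>

lemma ring_approx:
  fixes \<rho> :: "'a set \<Rightarrow> real"
  assumes R0: "R0 \<in> generated_ring"
    and empty: "\<rho> {} = 0"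
    and mono: "\<And>C D. C \<in> sets borel \<Longrightarrow> D \<in> sets borel \<Longrightarrow> C \<subseteq> D \<Longrightarrow> D \<subseteq> R0 \<Longrightarrow> \<rho> C \<le> \<rho> D"
    and sub: "\<And>C D. C \<in> sets borel \<Longrightarrow> D \<in> sets borel \<Longrightarrow> C \<subseteq> R0 \<Longrightarrow> D \<subseteq> R0 \<Longrightarrow>
        \<rho> (C \<union> D) \<le> \<rho> C + \<rho> D"
    and cont: "\<And>D. range D \<subseteq> sets borel \<Longrightarrow> (\<And>n. D n \<subseteq> R0) \<Longrightarrow> decseq D \<Longrightarrow> (\<Inter>n. D n) = {} \<Longrightarrow>
        (\<lambda>n. \<rho> (D n)) \<longlonglongrightarrow> 0"
    and B: "B \<in> sets borel" and e: "e > 0"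
  shows "\<exists>R\<in>generated_ring. R \<subseteq> R0 \<and> \<rho> (sym_diff (B \<inter> R0) R) < e"
proof -
  have R0b: "R0 \<in> sets borel" using ring_borel[OF R0] .
  have sub_sum: "\<rho> (\<Union>i<n. C i) \<le> (\<Sum>i<n. \<rho> (C i))"
    if "\<And>i. C i \<in> sets borel" "\<And>i. C i \<subseteq> R0" for C :: "nat \<Rightarrow> 'a set" and n
  proof (induction n)
    case (Suc n)
    have "\<rho> (\<Union>i<Suc n. C i) = \<rho> ((\<Union>i<n. C i) \<union> C n)" by (simp add: lessThan_Suc Un_commute)
    also have "\<dots> \<le> \<rho> (\<Union>i<n. C i) + \<rho> (C n)" using that by (intro sub) auto
    finally show ?case using Suc by simp
  qed (simp add: empty)
  show ?thesis
    using B[folded sigma_ring] e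
  proof (induction arbitrary: e rule: sigma_sets.induct)
    case (Basic a)
    then have "a \<inter> R0 \<in> generated_ring" using R0 by auto
    then show ?case using Basic by (intro bexI[of _ "a \<inter> R0"]) (auto simp: empty)
  next
    case Empty
    then show ?case using generated_ring_empty by (intro bexI[of _ "{}"]) (auto simp: empty)
  next
    case (Compl a)
    then obtain R where R: "R \<in> generated_ring" "R \<subseteq> R0" "\<rho> (sym_diff (a \<inter> R0) R) < e" by blast
    have "sym_diff ((UNIV - a) \<inter> R0) (R0 - R) = sym_diff (a \<inter> R0) R" using R(2) by blast
    with R R0 show ?case by (intro bexI[of _ "R0 - R"]) auto
  next
    case (Union a)
    have a: "a i \<in> sets borel" for i using Union(1) by (simp add: sigma_ring)
    \<comment> \<open>The part of the union missed by the first n sets decreases to the empty set,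
      so \<open>cont\<close> makes it small and only finitely many sets remain to be
      approximated.\<close>
    define D where "D n = R0 \<inter> ((\<Union>i. a i) - (\<Union>i<n. a i))" for n
    have "(\<lambda>n. \<rho> (D n)) \<longlonglongrightarrow> 0"
    proof (rule cont)
      show "range D \<subseteq> sets borel" using a R0b by (auto simp: D_def)
      show "decseq D" by (auto simp: D_def decseq_def)
      show "(\<Inter>n. D n) = {}" by (auto simp: D_def)
    qed (auto simp: D_def)
    then have "\<forall>\<^sub>F n in sequentially. \<rho> (D n) < e / 2"
      using Union(3) by (intro order_tendstoD) auto
    then obtain n where n: "\<rho> (D n) < e / 2"
      by (auto simp: eventually_sequentially)
    \<comment> \<open>The tail takes e/2 and the n remaining sets share the other half; n + 1 in the
      denominator covers n = 0.\<close>
    define \<delta> where "\<delta> = e / (2 * (real n + 1))"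
    have \<delta>: "\<delta> > 0" "real n * \<delta> \<le> e / 2" using Union(3) by (auto simp: \<delta>_def field_simps)
    have "\<forall>i. \<exists>R\<in>generated_ring. R \<subseteq> R0 \<and> \<rho> (sym_diff (a i \<inter> R0) R) < \<delta>"
      using Union(2)[OF \<delta>(1)] by blast
    then obtain R where R: "\<And>i. R i \<in> generated_ring" "\<And>i. R i \<subseteq> R0"
      "\<And>i. \<rho> (sym_diff (a i \<inter> R0) (R i)) < \<delta>" by metis
    have Rb: "R i \<in> sets borel" for i using ring_borel[OF R(1)] .
    have Db: "D n \<in> sets borel" "D n \<subseteq> R0" using a R0b by (auto simp: D_def)
    have Sb: "sym_diff (a i \<inter> R0) (R i) \<in> sets borel" "sym_diff (a i \<inter> R0) (R i) \<subseteq> R0" for i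
      using a R0b Rb R(2) by auto
    have subset: "sym_diff ((\<Union>i. a i) \<inter> R0) (\<Union>i<n. R i) \<subseteq> D n \<union> (\<Union>i<n. sym_diff (a i \<inter> R0) (R i))"
    proof
      fix x assume x: "x \<in> sym_diff ((\<Union>i. a i) \<inter> R0) (\<Union>i<n. R i)"
      show "x \<in> D n \<union> (\<Union>i<n. sym_diff (a i \<inter> R0) (R i))"
      proof (cases "x \<in> (\<Union>i. a i) \<inter> R0")
        case True
        with x have "\<forall>i<n. x \<notin> R i" by blast
        with True show ?thesis by (cases "\<exists>i<n. x \<in> a i") (auto simp: D_def)
      next
        case False
        with x obtain i where i: "i < n" "x \<in> R i" by blast
        with False R(2) have "x \<notin> a i" by blast
        with i show ?thesis by blast
      qed
    qed
    have "\<rho> (sym_diff ((\<Union>i. a i) \<inter> R0) (\<Union>i<n. R i)) \<le>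
        \<rho> (D n \<union> (\<Union>i<n. sym_diff (a i \<inter> R0) (R i)))"
    proof (rule mono[OF _ _ subset])
      show "sym_diff ((\<Union>i. a i) \<inter> R0) (\<Union>i<n. R i) \<in> sets borel" using a Rb R0b by auto
      show "D n \<union> (\<Union>i<n. sym_diff (a i \<inter> R0) (R i)) \<in> sets borel"
        using Db(1) a R0b Rb by auto
      show "D n \<union> (\<Union>i<n. sym_diff (a i \<inter> R0) (R i)) \<subseteq> R0" using Db(2) Sb(2) by blast
    qed
    also have "\<dots> \<le> \<rho> (D n) + \<rho> (\<Union>i<n. sym_diff (a i \<inter> R0) (R i))"
    proof (rule sub[OF Db(1) _ Db(2)])
      show "(\<Union>i<n. sym_diff (a i \<inter> R0) (R i)) \<in> sets borel"
        using a R0b Rb by auto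
      show "(\<Union>i<n. sym_diff (a i \<inter> R0) (R i)) \<subseteq> R0" using Sb(2) by blast
    qed
    also have "\<rho> (\<Union>i<n. sym_diff (a i \<inter> R0) (R i)) \<le> (\<Sum>i<n. \<rho> (sym_diff (a i \<inter> R0) (R i)))"
      by (rule sub_sum) (rule Sb)+
    also have "\<dots> \<le> (\<Sum>i<n. \<delta>)" using R(3) by (intro sum_mono) (auto intro: less_imp_le)
    also have "\<dots> \<le> e / 2" using \<delta> by simp
    finally have "\<rho> (sym_diff ((\<Union>i. a i) \<inter> R0) (\<Union>i<n. R i)) < e" using n by simp
    then show ?case using R by (intro bexI[of _ "\<Union>i<n. R i"]) auto
  qed
qed

text \<open>The Borel sets on which one measure is below another need not be closed under
  complements, so a Dynkin argument is of no use here. Instead, inside \<open>exh n\<close>, a ring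
  set approximates B with respect to the sum of the two measures, hence for both at once, and the
  inequality on the ring passes to B up to e.\<close>

lemma Mspace_le_ring:
  assumes "\<alpha> \<in> Mspace" "\<beta> \<in> Mspace"
    and le: "\<And>R. R \<in> generated_ring \<Longrightarrow> emeasure \<alpha> R \<le> emeasure \<beta> R"
    and B: "B \<in> sets borel"
  shows "emeasure \<alpha> B \<le> emeasure \<beta> B"
proof -
  have fin: "\<gamma> \<in> Mspace \<Longrightarrow> C \<in> sets borel \<Longrightarrow> C \<subseteq> exh n \<Longrightarrow> C \<in> fmeasurable \<gamma>" for C n \<gamma>
    using ring_bounded[OF exh_ring[of n]] bounded_subset by (intro Mspace_fmeasurable) auto
  have exhb: "exh n \<in> sets borel" for n using ring_borel[OF exh_ring] .
  have meas: "measure \<alpha> (B \<inter> exh n) \<le> measure \<beta> (B \<inter> exh n)" for n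
  proof (rule field_le_epsilon)
    fix e :: real assume e: "e > 0"
    define \<rho> where "\<rho> D = measure \<alpha> D + measure \<beta> D" for D
    have "\<exists>R\<in>generated_ring. R \<subseteq> exh n \<and> \<rho> (sym_diff (B \<inter> exh n) R) < e"
    proof (rule ring_approx[OF exh_ring])
      show "\<rho> C \<le> \<rho> D" if "C \<in> sets borel" "D \<in> sets borel" "C \<subseteq> D" "D \<subseteq> exh n" for C D
        unfolding \<rho>_def using that assms(1,2) fin
        by (intro add_mono measure_mono_fmeasurable) (auto simp: Mspace_sets)
      show "\<rho> (C \<union> D) \<le> \<rho> C + \<rho> D"
        if "C \<in> sets borel" "D \<in> sets borel" "C \<subseteq> exh n" "D \<subseteq> exh n" for C D
        using measure_Un_le[of C \<alpha> D] measure_Un_le[of C \<beta> D] that assms(1,2)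
        by (auto simp: \<rho>_def Mspace_sets)
      show "(\<lambda>k. \<rho> (D k)) \<longlonglongrightarrow> 0"
        if D: "range D \<subseteq> sets borel" "\<And>k. D k \<subseteq> exh n" "decseq D" "(\<Inter>k. D k) = {}" for D
      proof -
        have "(\<lambda>k. measure \<gamma> (D k)) \<longlonglongrightarrow> 0" if "\<gamma> \<in> Mspace" for \<gamma>
          using Lim_measure_decseq[of D \<gamma>] D that fin[OF that _ D(2)]
          by (auto simp: Mspace_sets fmeasurable_def less_top)
        from tendsto_add[OF this this, OF assms(1,2)] show ?thesis by (simp add: \<rho>_def)
      qed
    qed (use B e in \<open>auto simp: \<rho>_def\<close>)
    then obtain R where R: "R \<in> generated_ring" "R \<subseteq> exh n" "\<rho> (sym_diff (B \<inter> exh n) R) < e" by blast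
    have Rb: "R \<in> sets borel" using ring_borel[OF R(1)] .
    have d: "measure \<gamma> C \<le> measure \<gamma> D + measure \<gamma> E"
      if "\<gamma> \<in> Mspace" "C \<in> sets borel" "D \<in> sets borel" "E \<in> sets borel" "C \<subseteq> D \<union> E" "D \<subseteq> exh n" "E \<subseteq> exh n"
      for \<gamma> C D E
    proof -
      have "measure \<gamma> C \<le> measure \<gamma> (D \<union> E)"
        using that fin[OF that(1), of "D \<union> E" n]
        by (intro measure_mono_fmeasurable) (auto simp: Mspace_sets)
      also have "\<dots> \<le> measure \<gamma> D + measure \<gamma> E"
        using that by (intro measure_Un_le) (auto simp: Mspace_sets)
      finally show ?thesis .
    qed
    have "measure \<alpha> (B \<inter> exh n) \<le> measure \<alpha> R + measure \<alpha> (sym_diff (B \<inter> exh n) R)"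
      using B Rb exhb R(2) by (intro d assms(1)) auto
    also have "measure \<alpha> R \<le> measure \<beta> R"
      unfolding measure_def using le[OF R(1)] fin[OF assms(2) Rb R(2)]
      by (intro enn2real_mono) (auto simp: fmeasurable_def)
    also have "measure \<beta> R \<le> measure \<beta> (B \<inter> exh n) + measure \<beta> (sym_diff (B \<inter> exh n) R)"
      using B Rb exhb R(2) by (intro d assms(2)) auto
    finally show "measure \<alpha> (B \<inter> exh n) \<le> measure \<beta> (B \<inter> exh n) + e"
      using R(3) by (simp add: \<rho>_def)
  qed
  have "emeasure \<alpha> (B \<inter> exh n) \<le> emeasure \<beta> (B \<inter> exh n)" for n
  proof -
    have "emeasure \<gamma> (B \<inter> exh n) = ennreal (measure \<gamma> (B \<inter> exh n))" if "\<gamma> \<in> Mspace" for \<gamma>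
      using fin[OF that, of "B \<inter> exh n" n] B exhb by (intro emeasure_eq_measure2) auto
    with assms(1,2) meas[of n] show ?thesis by (simp add: ennreal_leI)
  qed
  then show ?thesis
    unfolding emeasure_SUP_exh[OF assms(1) B] emeasure_SUP_exh[OF assms(2) B]
    by (intro SUP_mono) auto
qed

end

subsection \<open>Encoding measures by real sequences\<close>

lemma finite_measure_compact_subset:
  fixes \<nu> :: "'a::polish_space measure"
  assumes \<nu>: "finite_measure \<nu>" "sets \<nu> = sets borel" and B: "B \<in> sets borel" and d: "d > 0"
  obtains K where "compact K" "K \<subseteq> B" "measure \<nu> (B - K) < d"
proof -
  interpret finite_measure \<nu> by fact
  have "\<exists>K\<in>{K. K \<subseteq> B \<and> compact K}. emeasure \<nu> B < emeasure \<nu> K + ennreal d"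
  proof (rule SUP_approx_ennreal[OF d])
    show "emeasure \<nu> B = (SUP K\<in>{K. K \<subseteq> B \<and> compact K}. emeasure \<nu> K)"
      by (rule inner_regular[OF \<nu>(2) _ B]) simp
  qed (use emeasure_finite in auto)
  then obtain K where K: "K \<subseteq> B" "compact K" "emeasure \<nu> B < emeasure \<nu> K + ennreal d" by blast
  have Kb: "K \<in> sets \<nu>" using K(2) \<nu>(2) by (simp add: borel_compact)
  have "ennreal (measure \<nu> B) < ennreal (measure \<nu> K + d)"
    using K(3) d by (simp add: emeasure_eq_measure)
  then have "measure \<nu> B < measure \<nu> K + d"
    using ennreal_less_iff[of "measure \<nu> B"] by simp
  then have "measure \<nu> (B - K) < d"
    using finite_measure_Diff[of B K] B Kb K(1) \<nu>(2) by simp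
  with K show thesis by (intro that) auto
qed

text \<open>A Lusin-type argument for countably many indicators at once. For each R in F, both
  \<open>T \<inter> R\<close> and \<open>T - R\<close> are approximated from inside by compact sets;
  on the intersection L of these unions the trace of R equals the trace of a compact set.\<close>

lemma compact_making_closed:
  fixes \<nu> :: "'a::polish_space measure"
  assumes \<nu>: "finite_measure \<nu>" "sets \<nu> = sets borel"
    and F: "countable F" "F \<noteq> {}" "F \<subseteq> sets borel" and T: "T \<in> sets borel" and e: "e > 0"
  obtains L where "compact L" "L \<subseteq> T" "\<And>R. R \<in> F \<Longrightarrow> closed (R \<inter> L)" "measure \<nu> (T - L) < e"
proof -
  interpret finite_measure \<nu> by fact
  define r where "r = from_nat_into F"
  have r: "r i \<in> F" for i unfolding r_def by (rule from_nat_into) fact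
  have rb: "r i \<in> sets borel" for i using r F(3) by blast
  \<comment> \<open>Each index loses less than \<open>d i\<close> twice, and the numbers
    \<open>2 * d i\<close> add up to e/2, which leaves the final inequality strict.\<close>
  define d where "d i = e / 8 * (1/2)^i" for i :: nat
  have d: "d i > 0" for i using e by (simp add: d_def)
  have "\<exists>K. compact K \<and> K \<subseteq> T \<inter> r i \<and> measure \<nu> (T \<inter> r i - K) < d i" for i
    by (rule finite_measure_compact_subset[OF \<nu> _ d, of "T \<inter> r i"]) (use T rb in auto)
  then obtain K where K: "\<And>i. compact (K i)" "\<And>i. K i \<subseteq> T \<inter> r i"
    "\<And>i. measure \<nu> (T \<inter> r i - K i) < d i" by metis
  have "\<exists>K. compact K \<and> K \<subseteq> T - r i \<and> measure \<nu> (T - r i - K) < d i" for i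
    by (rule finite_measure_compact_subset[OF \<nu> _ d, of "T - r i"]) (use T rb in auto)
  then obtain K' where K': "\<And>i. compact (K' i)" "\<And>i. K' i \<subseteq> T - r i"
    "\<And>i. measure \<nu> (T - r i - K' i) < d i" by metis
  have Kb: "K i \<in> sets borel" "K' i \<in> sets borel" for i
    using K(1) K'(1) by (auto intro: borel_compact)
  define L where "L = (\<Inter>i. K i \<union> K' i)"
  have cL: "compact L"
  proof -
    have "closed L"
      unfolding L_def using K(1) K'(1) by (intro closed_INT) (auto intro!: compact_imp_closed)
    moreover have "L = (K 0 \<union> K' 0) \<inter> L" unfolding L_def by blast
    ultimately show ?thesis using K(1) K'(1) by (metis compact_Un compact_Int_closed)
  qed
  have LT: "L \<subseteq> T" unfolding L_def using K(2) K'(2) by blast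
  have "closed (R \<inter> L)" if R: "R \<in> F" for R
  proof -
    obtain i where i: "R = r i" using R F unfolding r_def by (metis from_nat_into_surj)
    have "L \<subseteq> K i \<union> K' i" unfolding L_def by blast
    then have "R \<inter> L = K i \<inter> L" using K(2)[of i] K'(2)[of i] i by auto
    then show ?thesis using cL K(1)[of i] by (simp add: compact_imp_closed closed_Int)
  qed
  moreover have "measure \<nu> (T - L) < e"
  proof -
    define N where "N i = (T \<inter> r i - K i) \<union> (T - r i - K' i)" for i
    have Nb: "N i \<in> sets \<nu>" for i using Kb rb T \<nu>(2) by (auto simp: N_def)
    have Nd: "measure \<nu> (N i) \<le> 2 * d i" for i
    proof -
      have "measure \<nu> (N i) \<le> measure \<nu> (T \<inter> r i - K i) + measure \<nu> (T - r i - K' i)"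
        unfolding N_def using Kb rb T \<nu>(2) by (intro measure_Un_le) auto
      then show ?thesis using K(3)[of i] K'(3)[of i] by simp
    qed
    have sums: "(\<lambda>i. 2 * d i) sums (e / 2)"
      using sums_mult[OF geometric_sums[of "1/2::real"], of "e/4"] by (simp add: d_def field_simps)
    have sN: "summable (\<lambda>i. measure \<nu> (N i))"
      using Nd by (intro summable_comparison_test'[OF sums_summable[OF sums]]) auto
    have "T - L \<subseteq> (\<Union>i. N i)" unfolding L_def N_def by blast
    then have "measure \<nu> (T - L) \<le> measure \<nu> (\<Union>i. N i)"
      using Nb by (intro finite_measure_mono) auto
    also have "\<dots> \<le> (\<Sum>i. measure \<nu> (N i))"
      using Nb sN by (intro finite_measure_subadditive_countably) auto
    also have "\<dots> \<le> (\<Sum>i. 2 * d i)"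
      using Nd sN sums by (intro suminf_le) (auto simp: sums_iff)
    also have "\<dots> = e / 2" using sums by (simp add: sums_iff)
    finally show ?thesis using e by simp
  qed
  ultimately show thesis using that cL LT by blast
qed

text \<open>The previous lemma is applied again and again to what is left of A, with the remainder
  forced below 1/(n+1) at stage n. The pieces are the increments of an increasing sequence of
  stages, hence disjoint.\<close>

lemma compact_exhaustion_making_closed:
  fixes \<nu> :: "'a::polish_space measure"
  assumes \<nu>: "finite_measure \<nu>" "sets \<nu> = sets borel"
    and F: "countable F" "F \<noteq> {}" "F \<subseteq> sets borel" and A: "A \<in> sets borel"
  obtains L :: "nat \<Rightarrow> 'a set" where "\<And>k. compact (L k)" "\<And>k. L k \<subseteq> A" "disjoint_family L"
    "\<And>R k. R \<in> F \<Longrightarrow> closed (R \<inter> L k)" "measure \<nu> (A - (\<Union>k. L k)) = 0"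
proof -
  interpret finite_measure \<nu> by fact
  define Q where "Q n S S' \<longleftrightarrow> S \<subseteq> S' \<and> compact (S' - S) \<and> (\<forall>R\<in>F. closed (R \<inter> (S' - S))) \<and>
     measure \<nu> (A - S') < 1 / real (Suc n)" for n :: nat and S S' :: "'a set"
  define ok where "ok S \<longleftrightarrow> S \<in> sets borel \<and> S \<subseteq> A" for S
  have "\<exists>f. (\<forall>n::nat. ok (f n)) \<and> f 0 = {} \<and> (\<forall>n. Q n (f n) (f (Suc n)))"
  proof -
    have step: "\<exists>S'. ok S' \<and> Q n S S'" if "ok S" for n S
    proof -
      have "A - S \<in> sets borel" using A that by (auto simp: ok_def)
      then obtain L where L: "compact L" "L \<subseteq> A - S" "\<And>R. R \<in> F \<Longrightarrow> closed (R \<inter> L)"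
        "measure \<nu> (A - S - L) < 1 / real (Suc n)"
        by (rule compact_making_closed[OF \<nu> F, of "A - S" "1 / real (Suc n)"]) auto
      have "S \<union> L - S = L" "A - (S \<union> L) = A - S - L" using L(2) by auto
      then have "ok (S \<union> L) \<and> Q n S (S \<union> L)"
        using L that by (auto simp: ok_def Q_def borel_compact)
      then show ?thesis by blast
    qed
    \<comment> \<open>The clause for n = 0 makes the first stage empty; otherwise the increments
      would not recover the union of the stages.\<close>
    have "\<exists>f. \<forall>n::nat. (ok (f n) \<and> (n = 0 \<longrightarrow> f n = {})) \<and> Q n (f n) (f (Suc n))"
    proof (rule dependent_nat_choice)
      show "\<exists>x. ok x \<and> (0 = (0::nat) \<longrightarrow> x = {})" by (auto simp: ok_def)
      show "\<exists>y. (ok y \<and> (Suc n = 0 \<longrightarrow> y = {})) \<and> Q n x y" if "ok x \<and> (n = 0 \<longrightarrow> x = {})" for x n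
        using step[of x n] that by auto
    qed
    then show ?thesis by blast
  qed
  then obtain f where f: "\<And>n. ok (f n)" "f 0 = {}" "\<And>n. Q n (f n) (f (Suc n))" by blast
  define L where "L n = f (Suc n) - f n" for n
  have UN_L: "(\<Union>k. L k) = (\<Union>k. f k)"
  proof -
    have "f n \<subseteq> (\<Union>k. L k)" for n
      by (induction n) (auto simp: f(2) L_def)
    then show ?thesis by (auto simp: L_def)
  qed
  have "measure \<nu> (A - (\<Union>k. L k)) \<le> 1 / real (Suc n)" for n
  proof -
    have "measure \<nu> (A - (\<Union>k. L k)) \<le> measure \<nu> (A - f (Suc n))"
      unfolding UN_L using f(1)[of "Suc n"] A \<nu>(2) by (intro finite_measure_mono) (auto simp: ok_def)
    with f(3)[of n] show ?thesis by (simp add: Q_def)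
  qed
  then have "measure \<nu> (A - (\<Union>k. L k)) \<le> 0"
    by (intro LIMSEQ_le_const[OF LIMSEQ_inverse_real_of_nat]) (auto simp: inverse_eq_divide)
  then have "measure \<nu> (A - (\<Union>k. L k)) = 0" by (simp add: measure_le_0_iff)
  moreover have "compact (L k)" "L k \<subseteq> A" "R \<in> F \<Longrightarrow> closed (R \<inter> L k)" for k R
    using f(1)[of "Suc k"] f(3)[of k] by (auto simp: Q_def L_def ok_def)
  moreover have "disjoint_family L"
    unfolding L_def using f(3) by (intro disjoint_family_Suc) (auto simp: Q_def)
  ultimately show thesis using that by blast
qed

text \<open>A measure concentrated on \<open>\<Union>k. L k\<close> is encoded by the sequence of its values on the sets
  \<open>coord n\<close>; \<open>ix R k\<close> is an index with \<open>coord (ix R k) = R \<inter> L k\<close>.\<close>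

locale compact_pieces = dissecting_semiring I for I :: "'a::polish_space set set" +
  fixes L :: "nat \<Rightarrow> 'a set"
  assumes compact_L: "\<And>k. compact (L k)"
    and disjoint_L: "disjoint_family L"
    and closed_L: "\<And>R k. R \<in> generated_ring \<Longrightarrow> closed (R \<inter> L k)"
begin

section \<open>Admissible sequences and the measures they determine\<close>

definition ix :: "'a set \<Rightarrow> nat \<Rightarrow> nat" where
  "ix R k = prod_encode (to_nat_on generated_ring R, k)"

definition coord :: "nat \<Rightarrow> 'a set" where
  "coord n = from_nat_into generated_ring (fst (prod_decode n)) \<inter> L (snd (prod_decode n))"

text \<open>Countably many conditions on coordinates: on each piece a non-negative finitely additive
  set function on the ring, and summability over the pieces. The condition for
  \<open>R \<inter> L k = {}\<close> ties the k-th set function to the traces on \<open>L k\<close>,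
  so that compactness of \<open>L k\<close> can supply countable additivity.\<close>

definition codes :: "(nat \<Rightarrow> real) set" where
  "codes = {x. (\<forall>R\<in>generated_ring. \<forall>k. 0 \<le> x (ix R k)) \<and>
     (\<forall>R\<in>generated_ring. \<forall>S\<in>generated_ring. R \<inter> S = {} \<longrightarrow>
        (\<forall>k. x (ix (R \<union> S) k) = x (ix R k) + x (ix S k))) \<and>
     (\<forall>R\<in>generated_ring. \<forall>k. R \<inter> L k = {} \<longrightarrow> x (ix R k) = 0) \<and>
     (\<forall>R\<in>generated_ring. (\<Sum>k. ennreal (x (ix R k))) < \<infinity>)}"

text \<open>The choice is harmless, since by \<open>Mspace_le_ring\<close> two measures of
  \<open>Mspace\<close> that agree on the ring agree on all Borel sets. The null measure as default
  keeps the values in \<open>Mspace\<close> off \<open>codes\<close>.\<close>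

definition decode :: "(nat \<Rightarrow> real) \<Rightarrow> 'a measure" where
  "decode x = (if x \<in> codes
     then SOME \<mu>. \<mu> \<in> Mspace \<and> (\<forall>R\<in>generated_ring. emeasure \<mu> R = (\<Sum>k. ennreal (x (ix R k))))
     else null_measure borel)"

lemma coord_ix: "R \<in> generated_ring \<Longrightarrow> coord (ix R k) = R \<inter> L k"
  by (simp add: coord_def ix_def from_nat_into_to_nat_on[OF countable_ring])

lemma L_borel: "L k \<in> sets borel"
  using compact_L by (rule borel_compact)

lemma coord_borel: "coord n \<in> sets borel"
  unfolding coord_def using ring_borel[OF from_nat_into_ring] L_borel by auto

lemma coord_bounded: "bounded (coord n)"
  unfolding coord_def using ring_bounded[OF from_nat_into_ring] by (rule bounded_subset) auto

lemma coord_subset: "coord n \<subseteq> (\<Union>k. L k)"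
  by (auto simp: coord_def)

lemma codes_borel [measurable]: "codes \<in> sets borel"
proof -
  note [measurable] = measurable_product_coordinates
  have le: "Measurable.pred borel (\<lambda>x :: nat \<Rightarrow> real. 0 \<le> x i)" for i by measurable
  have eq: "Measurable.pred borel (\<lambda>x :: nat \<Rightarrow> real. x i = x j + x k)" for i j k
    unfolding pred_def by (intro borel_measurable_eq) measurable
  have zero: "Measurable.pred borel (\<lambda>x :: nat \<Rightarrow> real. x i = 0)" for i
    unfolding pred_def by (intro borel_measurable_eq) measurable
  have fin: "Measurable.pred borel (\<lambda>x :: nat \<Rightarrow> real. (\<Sum>k. ennreal (x (h k))) < \<infinity>)" for h
    by measurable
  have ball: "Measurable.pred borel (\<lambda>x. \<forall>R\<in>generated_ring. Q R x)"
    if "\<And>R. Measurable.pred borel (Q R)" for Q :: "'a set \<Rightarrow> (nat \<Rightarrow> real) \<Rightarrow> bool"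
  proof -
    have "(\<forall>R\<in>generated_ring. Q R x) \<longleftrightarrow> (\<forall>i. Q (from_nat_into generated_ring i) x)" for x
      using from_nat_into_ring from_nat_into_to_nat_on[OF countable_ring] by metis
    then show ?thesis using that by simp
  qed
  have "Measurable.pred borel (\<lambda>x. x \<in> codes)"
    unfolding codes_def mem_Collect_eq
    by (intro pred_intros_logic(3,4) pred_intros_countable(1) ball le eq zero fin) simp_all
  then show ?thesis by (simp add: pred_def)
qed

text \<open>By Caratheodory, finite additivity and continuity at the empty set suffice. If ring sets
  decrease to the empty set, their traces on the compact \<open>L k\<close> are closed, so one of
  them is already empty and the k-th value is exactly 0 from there on. Dominated convergence for the
  counting measure, with the summable values of the first set as bound, then handles the sum over
  k.\<close>

lemma codes_imp_measure:
  assumes x: "x \<in> codes"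
  shows "\<exists>\<mu>\<in>Mspace. \<forall>R\<in>generated_ring. emeasure \<mu> R = (\<Sum>k. ennreal (x (ix R k)))"
proof -
  define F where "F R = (\<Sum>k. ennreal (x (ix R k)))" for R
  have nn: "R \<in> generated_ring \<Longrightarrow> 0 \<le> x (ix R k)" for R k
    using x by (auto simp: codes_def)
  have add: "R \<in> generated_ring \<Longrightarrow> S \<in> generated_ring \<Longrightarrow> R \<inter> S = {} \<Longrightarrow>
      x (ix (R \<union> S) k) = x (ix R k) + x (ix S k)" for R S k
    using x by (auto simp: codes_def)
  have zero: "R \<in> generated_ring \<Longrightarrow> R \<inter> L k = {} \<Longrightarrow> x (ix R k) = 0" for R k
    using x by (auto simp: codes_def)
  have fin: "R \<in> generated_ring \<Longrightarrow> F R < \<infinity>" for R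
    using x by (auto simp: codes_def F_def)
  have mono: "x (ix R k) \<le> x (ix S k)" if "R \<in> generated_ring" "S \<in> generated_ring" "R \<subseteq> S" for R S k
  proof -
    have "x (ix (R \<union> (S - R)) k) = x (ix R k) + x (ix (S - R) k)"
      using that by (intro add) auto
    also have "R \<union> (S - R) = S" using that by auto
    finally show ?thesis using nn[of "S - R" k] that by auto
  qed
  have "\<exists>\<mu> :: 'a set \<Rightarrow> ennreal. (\<forall>s \<in> generated_ring. \<mu> s = F s) \<and>
      measure_space UNIV (sigma_sets UNIV generated_ring) \<mu>"
  proof (rule ring.caratheodory_empty_continuous)
    show "positive generated_ring F"
      using zero[OF generated_ring_empty] by (simp add: positive_def F_def)
    show "additive generated_ring F"
      unfolding additive_def F_def
      by (auto simp: add nn ennreal_plus suminf_add)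
    fix D :: "nat \<Rightarrow> 'a set" assume D: "range D \<subseteq> generated_ring" "decseq D" "(\<Inter>i. D i) = {}"
    have Dr: "D i \<in> generated_ring" for i using D(1) by auto
    have ev: "\<forall>\<^sub>F i in sequentially. x (ix (D i) k) = 0" for k
    proof -
      obtain C where C: "finite C" "L k \<subseteq> (\<Union>i\<in>C. - (D i \<inter> L k))"
      proof (rule compactE_image[OF compact_L[of k], of UNIV "\<lambda>i. - (D i \<inter> L k)"])
        show "L k \<subseteq> (\<Union>i. - (D i \<inter> L k))" using D(3) by auto
        show "open (- (D i \<inter> L k))" for i by (rule open_Compl[OF closed_L[OF Dr]])
      qed auto
      obtain i where i: "\<forall>j\<in>C. j \<le> i" using C(1) finite_nat_set_iff_bounded_le by auto
      have "D i \<inter> L k = {}"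
      proof (rule equals0I)
        fix y assume y: "y \<in> D i \<inter> L k"
        then have "y \<in> (\<Union>i\<in>C. - (D i \<inter> L k))" using C(2) by blast
        with y obtain j where "j \<in> C" "y \<notin> D j" by blast
        moreover have "D i \<subseteq> D j" using D(2) i \<open>j \<in> C\<close> by (auto simp: decseq_def)
        ultimately show False using y by auto
      qed
      then have "D j \<inter> L k = {}" if "i \<le> j" for j using D(2) that by (auto simp: decseq_def)
      then show ?thesis using zero[OF Dr] by (intro eventually_sequentiallyI[of i]) simp
    qed
    have "(\<lambda>i. \<integral>\<^sup>+k. ennreal (x (ix (D i) k)) \<partial>count_space UNIV)
      \<longlonglongrightarrow> (\<integral>\<^sup>+k. 0 \<partial>count_space (UNIV :: nat set))"
    proof (rule nn_integral_dominated_convergence)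
      show "(\<integral>\<^sup>+k. ennreal (x (ix (D 0) k)) \<partial>count_space UNIV) < \<infinity>"
        using fin[OF Dr[of 0]] by (simp add: nn_integral_count_space_nat F_def)
      show "AE k in count_space UNIV. ennreal (x (ix (D j) k)) \<le> ennreal (x (ix (D 0) k))" for j
        using D(2) by (auto intro!: ennreal_leI mono Dr simp: decseq_def)
      show "AE k in count_space UNIV. (\<lambda>i. ennreal (x (ix (D i) k))) \<longlonglongrightarrow> 0"
      proof (intro AE_I2 tendsto_eventually)
        show "\<forall>\<^sub>F i in sequentially. ennreal (x (ix (D i) k)) = 0" for k
          using ev[of k] by eventually_elim simp
      qed
    qed auto
    then show "(\<lambda>i. F (D i)) \<longlonglongrightarrow> 0"
      by (simp add: nn_integral_count_space_nat F_def)
  next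
    show "F R \<noteq> \<infinity>" if "R \<in> generated_ring" for R using fin[OF that] by simp
  qed
  then obtain \<mu> :: "'a set \<Rightarrow> ennreal" where \<mu>: "\<And>R. R \<in> generated_ring \<Longrightarrow> \<mu> R = F R"
    "measure_space UNIV (sets borel) \<mu>" unfolding sigma_ring by blast
  define N where "N = measure_of UNIV (sets borel) \<mu>"
  have sets_N: "sets N = sets borel"
    unfolding N_def using sets.sigma_sets_eq[of "borel :: 'a measure"] by simp
  have em: "emeasure N B = \<mu> B" if "B \<in> sets borel" for B
    unfolding N_def using \<mu>(2) that by (intro emeasure_measure_of_sigma) (auto simp: measure_space_def)
  have emR: "emeasure N R = F R" if "R \<in> generated_ring" for R
    using em ring_borel that \<mu>(1) by auto
  have "emeasure N B < \<infinity>" if B: "B \<in> sets borel" "bounded B" for B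
  proof -
    obtain R where R: "R \<in> generated_ring" "B \<subseteq> R" using bounded_in_ring[OF B] .
    have "emeasure N B \<le> emeasure N R" using R ring_borel by (intro emeasure_mono) (auto simp: sets_N)
    also have "\<dots> < \<infinity>" using emR fin R by simp
    finally show ?thesis .
  qed
  then have "N \<in> Mspace" by (auto simp: Mspace_def sets_N)
  with emR show ?thesis by (auto simp: F_def)
qed

lemma decode_code:
  assumes "x \<in> codes"
  shows "decode x \<in> Mspace"
    and "R \<in> generated_ring \<Longrightarrow> emeasure (decode x) R = (\<Sum>k. ennreal (x (ix R k)))"
proof -
  have "decode x \<in> Mspace \<and> (\<forall>R\<in>generated_ring. emeasure (decode x) R = (\<Sum>k. ennreal (x (ix R k))))"
    unfolding decode_def using assms codes_imp_measure[OF assms]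
    by (simp only: if_True) (rule someI_ex, blast)
  then show "decode x \<in> Mspace"
    "R \<in> generated_ring \<Longrightarrow> emeasure (decode x) R = (\<Sum>k. ennreal (x (ix R k)))" by auto
qed

lemma decode_Mspace: "decode x \<in> Mspace"
  using decode_code(1)[of x] by (cases "x \<in> codes") (auto simp: decode_def Mspace_def)

lemma decode_measurable [measurable]: "decode \<in> measurable borel Mmeas"
proof (rule measurable_into_Mmeas_ring)
  fix R :: "'a set" assume R: "R \<in> generated_ring"
  have "(\<lambda>x. emeasure (decode x) R) = (\<lambda>x. if x \<in> codes then \<Sum>k. ennreal (x (ix R k)) else 0)"
    using decode_code(2)[OF _ R] by (auto simp: decode_def fun_eq_iff)
  also have "\<dots> \<in> borel_measurable borel" by measurable
  finally show "(\<lambda>x. emeasure (decode x) R) \<in> borel_measurable borel" .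
qed (rule decode_Mspace)

definition code :: "'a measure \<Rightarrow> nat \<Rightarrow> real" where
  "code \<mu> n = measure \<mu> (coord n)"

lemma emeasure_coord: "\<mu> \<in> Mspace \<Longrightarrow> emeasure \<mu> (coord n) = ennreal (code \<mu> n)"
  unfolding code_def
  by (intro emeasure_eq_measure2 Mspace_fmeasurable coord_borel coord_bounded)

lemma emeasure_Int_UN_L:
  assumes "\<mu> \<in> Mspace" "R \<in> generated_ring"
  shows "emeasure \<mu> (R \<inter> (\<Union>k. L k)) = (\<Sum>k. ennreal (code \<mu> (ix R k)))"
proof -
  have "(\<Sum>k. emeasure \<mu> (R \<inter> L k)) = emeasure \<mu> (\<Union>k. R \<inter> L k)"
    using assms disjoint_L ring_borel[OF assms(2)] L_borel
    by (intro suminf_emeasure) (auto simp: Mspace_sets disjoint_family_on_def)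
  also have "(\<Union>k. R \<inter> L k) = R \<inter> (\<Union>k. L k)" by auto
  finally have "emeasure \<mu> (R \<inter> (\<Union>k. L k)) = (\<Sum>k. emeasure \<mu> (R \<inter> L k))" by simp
  moreover have "emeasure \<mu> (R \<inter> L k) = ennreal (code \<mu> (ix R k))" for k
    using emeasure_coord[OF assms(1), of "ix R k"] by (simp add: coord_ix[OF assms(2)])
  ultimately show ?thesis by simp
qed

lemma code_in_codes:
  assumes "\<mu> \<in> Mspace" shows "code \<mu> \<in> codes"
  unfolding codes_def
proof (intro CollectI conjI ballI allI impI)
  fix R S k assume RS: "R \<in> generated_ring" "S \<in> generated_ring" "R \<inter> S = {}"
  have "measure \<mu> ((R \<inter> L k) \<union> (S \<inter> L k)) = measure \<mu> (R \<inter> L k) + measure \<mu> (S \<inter> L k)"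
  proof (rule measure_Un_AE)
    show "R \<inter> L k \<in> fmeasurable \<mu>" "S \<inter> L k \<in> fmeasurable \<mu>"
      using Mspace_fmeasurable[OF assms coord_borel coord_bounded] coord_ix RS by metis+
  qed (use RS in auto)
  moreover have "R \<union> S \<in> generated_ring" using RS by auto
  ultimately show "code \<mu> (ix (R \<union> S) k) = code \<mu> (ix R k) + code \<mu> (ix S k)"
    using RS by (simp add: code_def coord_ix Int_Un_distrib2)
next
  fix R assume R: "R \<in> generated_ring"
  have "emeasure \<mu> (R \<inter> (\<Union>k. L k)) \<le> emeasure \<mu> R"
    using ring_borel[OF R] assms by (intro emeasure_mono) (auto simp: Mspace_sets)
  also have "\<dots> < \<infinity>" using ring_bdd[OF R] assms by (intro Mspace_finite) auto
  finally show "(\<Sum>k. ennreal (code \<mu> (ix R k))) < \<infinity>"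
    using emeasure_Int_UN_L[OF assms R] by simp
qed (auto simp: code_def coord_ix)

lemma restrict_pieces:
  assumes "\<mu> \<in> Mspace"
  defines "\<beta> \<equiv> density \<mu> (indicator (\<Union>k. L k))"
  shows "\<beta> \<in> Mspace" and "B \<in> sets borel \<Longrightarrow> emeasure \<beta> B = emeasure \<mu> (B \<inter> (\<Union>k. L k))"
proof -
  have *: "emeasure \<beta> B = emeasure \<mu> (B \<inter> (\<Union>k. L k))" if "B \<in> sets borel" for B
    unfolding \<beta>_def using that L_borel assms(1)
    by (subst emeasure_restricted) (auto simp: Mspace_sets Int_commute)
  then show "B \<in> sets borel \<Longrightarrow> emeasure \<beta> B = emeasure \<mu> (B \<inter> (\<Union>k. L k))" .
  have "emeasure \<beta> B < \<infinity>" if B: "B \<in> sets borel" "bounded B" for B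
  proof -
    have "emeasure \<beta> B \<le> emeasure \<mu> B"
      unfolding *[OF B(1)] using B assms(1) by (intro emeasure_mono) (auto simp: Mspace_sets)
    also have "\<dots> < \<infinity>" using B assms(1) by (intro Mspace_finite) auto
    finally show ?thesis .
  qed
  then show "\<beta> \<in> Mspace" using assms(1) unfolding Mspace_def by (auto simp: \<beta>_def)
qed

text \<open>This carries the coordinatewise order over to the order of measures. Summing over the
  pieces compares the two on ring sets, and \<open>Mspace_le_ring\<close> does the rest. The measure
  \<mu> is cut down to the union of the pieces because its code sees nothing else. The sequence x is
  any admissible one, so the lemma applies to every point of a compact set of codes.\<close>

lemma decode_le:
  assumes x: "x \<in> codes" and \<mu>: "\<mu> \<in> Mspace" and le: "\<And>n. x n \<le> code \<mu> n"
    and B: "B \<in> sets borel"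
  shows "emeasure (decode x) B \<le> emeasure \<mu> (B \<inter> (\<Union>k. L k))"
proof -
  have "emeasure (decode x) B \<le> emeasure (density \<mu> (indicator (\<Union>k. L k))) B"
  proof (rule Mspace_le_ring[OF decode_Mspace restrict_pieces(1)[OF \<mu>] _ B])
    fix R assume R: "R \<in> generated_ring"
    have "(\<Sum>k. ennreal (x (ix R k))) \<le> (\<Sum>k. ennreal (code \<mu> (ix R k)))"
      by (intro suminf_le ennreal_leI le) auto
    then show "emeasure (decode x) R \<le> emeasure (density \<mu> (indicator (\<Union>k. L k))) R"
      by (simp add: decode_code(2)[OF x R] restrict_pieces(2)[OF \<mu> ring_borel[OF R]]
          emeasure_Int_UN_L[OF \<mu> R])
  qed
  then show ?thesis by (simp add: restrict_pieces(2)[OF \<mu> B])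
qed

lemma decode_eq:
  assumes \<mu>: "\<mu> \<in> Mspace" and B: "B \<in> sets borel"
  shows "emeasure (decode (code \<mu>)) B = emeasure \<mu> (B \<inter> (\<Union>k. L k))"
proof (rule antisym)
  show "emeasure (decode (code \<mu>)) B \<le> emeasure \<mu> (B \<inter> (\<Union>k. L k))"
    by (rule decode_le[OF code_in_codes[OF \<mu>] \<mu> _ B]) simp
  have "emeasure (density \<mu> (indicator (\<Union>k. L k))) B \<le> emeasure (decode (code \<mu>)) B"
    by (rule Mspace_le_ring[OF restrict_pieces(1)[OF \<mu>] decode_Mspace _ B])
      (simp add: decode_code(2)[OF code_in_codes[OF \<mu>]] restrict_pieces(2)[OF \<mu>] ring_borel
          emeasure_Int_UN_L[OF \<mu>])
  then show "emeasure \<mu> (B \<inter> (\<Union>k. L k)) \<le> emeasure (decode (code \<mu>)) B"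
    by (simp add: restrict_pieces(2)[OF \<mu> B])
qed

end

subsection \<open>Approximation of level sets\<close>

text \<open>The Lipschitz bound also says that u depends on the first m coordinates only. The
  constant m is the slope of \<open>hull_fun K m\<close>.\<close>

definition lip_incr :: "nat \<Rightarrow> ((nat \<Rightarrow> real) \<Rightarrow> real) \<Rightarrow> bool" where
  "lip_incr m u \<longleftrightarrow> (\<forall>x. 0 \<le> u x \<and> u x \<le> 1) \<and> (\<forall>x y. (\<forall>i. x i \<le> y i) \<longrightarrow> u x \<le> u y) \<and>
     (\<forall>x y. \<bar>u x - u y\<bar> \<le> real m * (\<Sum>i<m. \<bar>x i - y i\<bar>))"

lemma lip_incr_range: "lip_incr m u \<Longrightarrow> 0 \<le> u x" "lip_incr m u \<Longrightarrow> u x \<le> 1"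
  by (simp_all add: lip_incr_def)

lemma lip_incr_mono: "lip_incr m u \<Longrightarrow> (\<And>i. x i \<le> y i) \<Longrightarrow> u x \<le> u y"
  by (simp add: lip_incr_def)

lemma lip_incr_lip: "lip_incr m u \<Longrightarrow> \<bar>u x - u y\<bar> \<le> real m * (\<Sum>i<m. \<bar>x i - y i\<bar>)"
  by (simp add: lip_incr_def)

text \<open>Only finitely many coordinates enter the Lipschitz bound, so u is continuous for the
  product topology.\<close>

lemma lip_incr_measurable:
  assumes "lip_incr m u" shows "u \<in> borel_measurable borel"
proof -
  have "(u \<longlongrightarrow> u x) (at x)" for x
  proof -
    have coord: "((\<lambda>y. y i) \<longlongrightarrow> x i) (at x)" for i
    proof -
      have "isCont (\<lambda>y. y i) x"
        using continuous_on_product_coordinates[of i] continuous_on_eq_continuous_at[OF open_UNIV] by blast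
      then show ?thesis by (rule isContD)
    qed
    have "((\<lambda>y. real m * (\<Sum>i<m. \<bar>y i - x i\<bar>)) \<longlongrightarrow> real m * (\<Sum>i<m. \<bar>x i - x i\<bar>)) (at x)"
      by (intro tendsto_intros coord)
    then have lim: "((\<lambda>y. real m * (\<Sum>i<m. \<bar>y i - x i\<bar>)) \<longlongrightarrow> 0) (at x)" by simp
    have "((\<lambda>y. u y - u x) \<longlongrightarrow> 0) (at x)"
      by (rule Lim_null_comparison[OF _ lim]) (use lip_incr_lip[OF assms] in auto)
    then show ?thesis by (simp add: LIM_zero_iff)
  qed
  then show ?thesis
    by (intro borel_measurable_continuous_onI) (auto simp: continuous_on_eq_continuous_at continuous_at)
qed

text \<open>\<open>hull_fun K m\<close> depends on \<open>m\<close> coordinates only and tends to the indicator of the upward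
  closure of \<open>K\<close>.\<close>

definition hull_fun :: "(nat \<Rightarrow> real) set \<Rightarrow> nat \<Rightarrow> (nat \<Rightarrow> real) \<Rightarrow> real" where
  "hull_fun K m x =
     (if K = {} then 0 else max 0 (1 - real m * (INF y\<in>K. \<Sum>i<m. max 0 (y i - x i))))"

text \<open>For fixed y the total excess of y over x on the first m coordinates is non-increasing in
  x and 1-Lipschitz for the sum of coordinate distances. Both properties survive the infimum over K;
  multiplying by m gives the constant, and cutting at 0 does not increase it.\<close>

lemma hull_fun_lip_incr: "lip_incr m (hull_fun K m)"
proof (cases "K = {}")
  case True
  then show ?thesis by (simp add: lip_incr_def hull_fun_def sum_nonneg)
next
  case False
  define s where "s x y = (\<Sum>i<m. max 0 (y i - x i))" for x y :: "nat \<Rightarrow> real"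
  define d where "d x = (INF y\<in>K. s x y)" for x
  have h: "hull_fun K m x = max 0 (1 - real m * d x)" for x
    using False by (simp add: hull_fun_def d_def s_def)
  have s_nn: "s x y \<ge> 0" for x y unfolding s_def by (intro sum_nonneg) auto
  have bdd: "bdd_below (s x ` K)" for x using s_nn by (intro bdd_belowI2[of _ 0])
  have d_nn: "d x \<ge> 0" for x unfolding d_def using False s_nn by (intro cINF_greatest)
  have d_le: "d x \<le> d x' + c" if "\<And>y. s x y \<le> s x' y + c" for x x' c
  proof -
    have "d x - c \<le> d x'"
      unfolding d_def[of x']
    proof (rule cINF_greatest[OF False])
      fix y assume "y \<in> K"
      then have "d x \<le> s x y" unfolding d_def by (rule cINF_lower[OF bdd])
      with that[of y] show "d x - c \<le> s x' y" by simp
    qed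
    then show ?thesis by simp
  qed
  have mono: "d y \<le> d x" if "\<And>i. x i \<le> y i" for x y
  proof -
    have "s y z \<le> s x z + 0" for z
      unfolding s_def using that by (auto intro!: sum_mono max.mono)
    from d_le[of y x 0, OF this] show ?thesis by simp
  qed
  have half: "d x \<le> d y + (\<Sum>i<m. \<bar>x i - y i\<bar>)" for x y
    by (rule d_le) (auto simp: s_def sum.distrib[symmetric] intro!: sum_mono)
  have lip: "\<bar>d x - d y\<bar> \<le> (\<Sum>i<m. \<bar>x i - y i\<bar>)" for x y
    using half[of x y] half[of y x] by (simp add: abs_minus_commute)
  show ?thesis
    unfolding lip_incr_def h
  proof (intro conjI allI impI)
    fix x y :: "nat \<Rightarrow> real"
    show "max 0 (1 - real m * d x) \<le> 1" using d_nn[of x] by simp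
    show "max 0 (1 - real m * d x) \<le> max 0 (1 - real m * d y)" if "\<forall>i. x i \<le> y i"
      using mono[of x y] that by (intro max.mono diff_mono mult_left_mono) auto
    have "\<bar>max 0 (1 - real m * d x) - max 0 (1 - real m * d y)\<bar> \<le> \<bar>real m * d x - real m * d y\<bar>"
      by linarith
    also have "\<dots> = real m * \<bar>d x - d y\<bar>" by (simp add: abs_mult right_diff_distrib[symmetric])
    also have "\<dots> \<le> real m * (\<Sum>i<m. \<bar>x i - y i\<bar>)" by (intro mult_left_mono lip) simp
    finally show "\<bar>max 0 (1 - real m * d x) - max 0 (1 - real m * d y)\<bar> \<le>
        real m * (\<Sum>i<m. \<bar>x i - y i\<bar>)" .
  qed auto
qed

text \<open>If some element of K lies below x, every value is 1. Otherwise the sets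
  \<open>G m\<close> of sequences whose excess over x on the first m coordinates is more than 1/m
  are open, increase with m and cover K. By compactness one of them contains K, and from that index
  on the values are exactly 0.\<close>

lemma hull_fun_tendsto:
  assumes K: "compact K"
  shows "(\<lambda>m. hull_fun K m x) \<longlonglongrightarrow> (if \<exists>y\<in>K. \<forall>i. y i \<le> x i then 1 else 0)"
proof (cases "\<exists>y\<in>K. \<forall>i. y i \<le> x i")
  case True
  then obtain y where y: "y \<in> K" "\<And>i. y i \<le> x i" by blast
  have "hull_fun K m x = 1" for m
  proof -
    have "(INF y\<in>K. \<Sum>i<m. max 0 (y i - x i)) \<le> (\<Sum>i<m. max 0 (y i - x i))"
      using y(1) by (intro cINF_lower bdd_belowI2[of _ 0]) (auto intro: sum_nonneg)
    also have "\<dots> = 0" using y(2) by (intro sum.neutral) (simp add: max_absorb1)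
    finally have "real m * (INF y\<in>K. \<Sum>i<m. max 0 (y i - x i)) \<le> 0"
      by (simp add: mult_nonneg_nonpos)
    then have "hull_fun K m x \<ge> 1" using y(1) by (auto simp: hull_fun_def)
    with lip_incr_range(2)[OF hull_fun_lip_incr[of m K]] show ?thesis by (intro antisym)
  qed
  with True show ?thesis by simp
next
  case False
  define G where "G m = {y. 1 < real m * (\<Sum>i<m. max 0 (y i - x i))}" for m :: nat
  have mono: "G m \<subseteq> G n" if "m \<le> n" for m n
  proof
    fix y assume "y \<in> G m"
    moreover have "real m * (\<Sum>i<m. max 0 (y i - x i)) \<le> real n * (\<Sum>i<n. max 0 (y i - x i))"
      using that by (intro mult_mono sum_mono2 sum_nonneg) auto
    ultimately show "y \<in> G n" by (simp add: G_def)
  qed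
  have "\<exists>m. K \<subseteq> G m"
  proof -
    obtain C where C: "finite C" "K \<subseteq> (\<Union>m\<in>C. G m)"
    proof (rule compactE_image[OF K, of UNIV G])
      show "open (G m)" for m
        unfolding G_def by (intro open_Collect_less continuous_intros continuous_on_product_coordinates)
      show "K \<subseteq> (\<Union>m. G m)"
      proof
        fix y assume "y \<in> K"
        with False obtain i where i: "x i < y i" by (auto simp: not_le)
        then obtain k where k: "1 < real k * (y i - x i)"
          using reals_Archimedean3[of "y i - x i"] by auto
        \<comment> \<open>\<open>Suc i\<close> brings the coordinate i into the sum, and k makes its
          excess alone large enough.\<close>
        define m where "m = max k (Suc i)"
        have "1 < real m * (y i - x i)"
          using k i by (rule_tac less_le_trans[OF k]) (auto simp: m_def intro!: mult_right_mono)
        also have "\<dots> \<le> real m * (\<Sum>i<m. max 0 (y i - x i))"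
          using i member_le_sum[of i "{..<m}" "\<lambda>i. max 0 (y i - x i)"]
          by (intro mult_left_mono) (auto simp: m_def)
        finally show "y \<in> (\<Union>m. G m)" by (auto simp: G_def)
      qed
    qed auto
    obtain m where "\<forall>j\<in>C. j \<le> m" using C(1) finite_nat_set_iff_bounded_le by auto
    with C(2) mono have "K \<subseteq> G m" by blast
    then show ?thesis by blast
  qed
  then obtain m where m: "K \<subseteq> G m" by blast
  have "hull_fun K n x = 0" if "m \<le> n" for n
  proof (cases "K = {}")
    case False
    have Kn: "K \<subseteq> G n" using m mono[OF that] by blast
    then have n: "n > 0" using False by (auto simp: G_def intro: gr0I)
    have "1 / real n \<le> (INF y\<in>K. \<Sum>i<n. max 0 (y i - x i))"
    proof (rule cINF_greatest[OF False])
      fix y assume "y \<in> K"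
      then have "1 < real n * (\<Sum>i<n. max 0 (y i - x i))" using Kn by (auto simp: G_def)
      with n show "1 / real n \<le> (\<Sum>i<n. max 0 (y i - x i))" by (simp add: field_simps)
    qed
    then have "1 \<le> real n * (INF y\<in>K. \<Sum>i<n. max 0 (y i - x i))" using n by (simp add: field_simps)
    then show ?thesis by (simp add: hull_fun_def)
  qed (simp add: hull_fun_def)
  then have "(\<lambda>m. hull_fun K m x) \<longlonglongrightarrow> 0"
    by (intro tendsto_eventually eventually_sequentiallyI[of m]) simp
  then show ?thesis by (simp only: if_not_P[OF False])
qed

section \<open>Control measure and inner approximation of level sets\<close>

locale random_measure_semiring = dissecting_semiring I + prob_space P
  for I :: "'a::polish_space set set" and P :: "'w measure" +
  fixes M :: "'w \<Rightarrow> 'a measure"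
  assumes M_meas [measurable]: "M \<in> measurable P Mmeas"
begin

lemma M_Mspace: "\<omega> \<in> space P \<Longrightarrow> M \<omega> \<in> Mspace"
  using measurable_space[OF M_meas] by simp

lemma emeasure_M_measurable: "B \<in> sets borel \<Longrightarrow> (\<lambda>\<omega>. emeasure (M \<omega>) B) \<in> borel_measurable P"
  by (rule measurable_compose[OF M_meas[unfolded Mmeas_def] emeasure_measurable_Mmeas_on]) auto

lemma measure_M_measurable: "B \<in> sets borel \<Longrightarrow> (\<lambda>\<omega>. measure (M \<omega>) B) \<in> borel_measurable P"
  by (rule measurable_compose[OF M_meas[unfolded Mmeas_def] measure_measurable_Mmeas_on]) auto

lemma vec_M_measurable:
  "(\<And>i. C i \<in> sets borel) \<Longrightarrow> (\<lambda>\<omega> i. measure (M \<omega>) (C i)) \<in> borel_measurable P"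
  for C :: "nat \<Rightarrow> 'a set"
  by (intro measurable_coordinatewise_then_product measure_M_measurable)

text \<open>The intensity of M may be infinite, so M is reweighted before taking expectations. The
  factor \<open>c \<omega> n\<close> bounds the n-th term by 2^(-n), hence the total mass by 2. It
  is strictly positive, so a vanishing mean forces M to vanish almost surely on
  \<open>B \<inter> exh n\<close> for every n.\<close>

lemma control_measure:
  obtains \<nu> :: "'a measure" where "finite_measure \<nu>" "sets \<nu> = sets borel"
    "\<And>B. B \<in> sets borel \<Longrightarrow> measure \<nu> B = 0 \<Longrightarrow> AE \<omega> in P. emeasure (M \<omega>) B = 0"
proof -
  define c where "c \<omega> n = ennreal ((1/2)^n / (1 + measure (M \<omega>) (exh n)))" for \<omega> n
  define \<kappa> where "\<kappa> \<omega> B = (\<Sum>n. c \<omega> n * emeasure (M \<omega>) (B \<inter> exh n))" for \<omega> B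
  define \<nu> where "\<nu> = measure_of UNIV (sets borel) (\<lambda>B. \<integral>\<^sup>+\<omega>. \<kappa> \<omega> B \<partial>P)"
  have exhb: "exh n \<in> sets borel" for n using ring_borel[OF exh_ring] .
  have [measurable]: "(\<lambda>\<omega>. c \<omega> n) \<in> borel_measurable P" for n
    unfolding c_def using measure_M_measurable[OF exhb] by measurable
  have \<kappa>_meas [measurable]: "(\<lambda>\<omega>. \<kappa> \<omega> B) \<in> borel_measurable P" if "B \<in> sets borel" for B
    unfolding \<kappa>_def using emeasure_M_measurable[of "B \<inter> exh n" for n] that exhb by measurable
  have \<kappa>_le: "\<kappa> \<omega> B \<le> 2" if "\<omega> \<in> space P" "B \<in> sets borel" for \<omega> B
  proof -
    have "c \<omega> n * emeasure (M \<omega>) (B \<inter> exh n) \<le> ennreal ((1/2)^n)" for n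
    proof -
      have "emeasure (M \<omega>) (B \<inter> exh n) \<le> emeasure (M \<omega>) (exh n)"
        using M_Mspace[OF that(1)] exhb by (intro emeasure_mono) (auto simp: Mspace_sets)
      also have "\<dots> = ennreal (measure (M \<omega>) (exh n))"
        using M_Mspace[OF that(1)] ring_bdd[OF exh_ring]
        by (intro emeasure_eq_measure2 Mspace_fmeasurable) auto
      finally have "c \<omega> n * emeasure (M \<omega>) (B \<inter> exh n) \<le> c \<omega> n * ennreal (measure (M \<omega>) (exh n))"
        by (rule mult_left_mono) simp
      also have "\<dots> = ennreal ((1/2)^n * (measure (M \<omega>) (exh n) / (1 + measure (M \<omega>) (exh n))))"
        unfolding c_def by (simp add: ennreal_mult[symmetric])
      also have "\<dots> \<le> ennreal ((1/2)^n * 1)"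
        by (intro ennreal_leI mult_left_mono) (auto simp: divide_le_eq_1 add_pos_nonneg)
      finally show ?thesis by simp
    qed
    then have "\<kappa> \<omega> B \<le> (\<Sum>n. ennreal ((1/2)^n))"
      unfolding \<kappa>_def by (intro suminf_le) auto
    also have "\<dots> = ennreal (\<Sum>n. (1/2)^n)"
      by (intro suminf_ennreal2) (auto intro: summable_geometric)
    also have "\<dots> = 2" by (simp add: suminf_geometric)
    finally show ?thesis .
  qed
  have sets_\<nu>: "sets \<nu> = sets borel"
    unfolding \<nu>_def using sets.sigma_sets_eq[of "borel :: 'a measure"] by simp
  have em: "emeasure \<nu> B = (\<integral>\<^sup>+\<omega>. \<kappa> \<omega> B \<partial>P)" if "B \<in> sets borel" for B
    unfolding \<nu>_def
  proof (rule emeasure_measure_of_sigma[OF _ _ _ that])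
    show "sigma_algebra UNIV (sets (borel :: 'a measure))"
      using sets.sigma_algebra_axioms[of "borel :: 'a measure"] by simp
    show "positive (sets borel) (\<lambda>B. \<integral>\<^sup>+\<omega>. \<kappa> \<omega> B \<partial>P)" by (simp add: positive_def \<kappa>_def)
    show "countably_additive (sets borel) (\<lambda>B. \<integral>\<^sup>+\<omega>. \<kappa> \<omega> B \<partial>P)"
    proof (rule countably_additiveI)
      fix A :: "nat \<Rightarrow> 'a set"
      assume A: "range A \<subseteq> sets borel" "disjoint_family A"
      have Ab: "A i \<in> sets borel" for i using A(1) by auto
      have "(\<Sum>i. \<integral>\<^sup>+\<omega>. \<kappa> \<omega> (A i) \<partial>P) = (\<integral>\<^sup>+\<omega>. (\<Sum>i. \<kappa> \<omega> (A i)) \<partial>P)"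
        by (intro nn_integral_suminf[symmetric] \<kappa>_meas Ab)
      also have "\<dots> = (\<integral>\<^sup>+\<omega>. \<kappa> \<omega> (\<Union>i. A i) \<partial>P)"
      proof (rule nn_integral_cong)
        fix \<omega> assume \<omega>: "\<omega> \<in> space P"
        define g where "g i n = c \<omega> n * emeasure (M \<omega>) (A i \<inter> exh n)" for i n
        have g: "(\<Sum>i. g i n) = c \<omega> n * emeasure (M \<omega>) ((\<Union>i. A i) \<inter> exh n)" for n
        proof -
          have "(\<Sum>i. emeasure (M \<omega>) (A i \<inter> exh n)) = emeasure (M \<omega>) (\<Union>i. A i \<inter> exh n)"
            using A Ab exhb[of n] M_Mspace[OF \<omega>]
            by (intro suminf_emeasure) (auto simp: Mspace_sets disjoint_family_on_def)
          then show ?thesis by (simp add: g_def)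
        qed
        have "(\<Sum>i. \<kappa> \<omega> (A i)) = (\<Sum>i. \<integral>\<^sup>+n. g i n \<partial>count_space UNIV)"
          by (simp add: \<kappa>_def g_def nn_integral_count_space_nat)
        also have "\<dots> = (\<integral>\<^sup>+n. (\<Sum>i. g i n) \<partial>count_space UNIV)"
          by (intro nn_integral_suminf[symmetric]) simp
        also have "\<dots> = (\<Sum>n. \<Sum>i. g i n)" by (rule nn_integral_count_space_nat)
        finally show "(\<Sum>i. \<kappa> \<omega> (A i)) = \<kappa> \<omega> (\<Union>i. A i)" by (simp add: \<kappa>_def g)
      qed
      finally show "(\<Sum>i. \<integral>\<^sup>+\<omega>. \<kappa> \<omega> (A i) \<partial>P) = (\<integral>\<^sup>+\<omega>. \<kappa> \<omega> (\<Union>i. A i) \<partial>P)" .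
    qed
  qed
  have space_\<nu>: "space \<nu> = UNIV" using sets_eq_imp_space_eq[OF sets_\<nu>] by simp
  have fin: "finite_measure \<nu>"
  proof
    have "emeasure \<nu> (space \<nu>) = (\<integral>\<^sup>+\<omega>. \<kappa> \<omega> UNIV \<partial>P)"
      unfolding space_\<nu> by (rule em) simp
    also have "\<dots> \<le> (\<integral>\<^sup>+\<omega>. 2 \<partial>P)" by (intro nn_integral_mono \<kappa>_le) auto
    also have "\<dots> = 2" by (simp add: emeasure_space_1)
    finally show "emeasure \<nu> (space \<nu>) \<noteq> \<infinity>" by (auto simp: top_unique)
  qed
  have "AE \<omega> in P. emeasure (M \<omega>) B = 0" if B: "B \<in> sets borel" "measure \<nu> B = 0" for B
  proof -
    have "(\<integral>\<^sup>+\<omega>. \<kappa> \<omega> B \<partial>P) = 0"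
      using em[OF B(1)] B(2) finite_measure.emeasure_eq_measure[OF fin, of B] by simp
    then have "AE \<omega> in P. \<kappa> \<omega> B = 0" using B(1) by (simp add: nn_integral_0_iff_AE)
    then show ?thesis
    proof (rule AE_mp, intro AE_I2 impI)
      fix \<omega> assume \<omega>: "\<omega> \<in> space P" "\<kappa> \<omega> B = 0"
      have "c \<omega> n * emeasure (M \<omega>) (B \<inter> exh n) = 0" for n
        using \<omega>(2) unfolding \<kappa>_def by (subst (asm) suminf_eq_zero_iff) auto
      moreover have "c \<omega> n \<noteq> 0" for n
        by (simp add: c_def ennreal_eq_0_iff not_le add_pos_nonneg)
      ultimately have "emeasure (M \<omega>) (B \<inter> exh n) = 0" for n by (metis mult_eq_0_iff)
      then show "emeasure (M \<omega>) B = 0"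
        by (simp add: emeasure_SUP_exh[OF M_Mspace[OF \<omega>(1)] B(1)])
    qed
  qed
  then show thesis using that fin sets_\<nu> by blast
qed

text \<open>Inner regularity yields a compact set \<open>K\<close> of codes inside \<open>{f \<circ> decode > t}\<close>; since \<open>f\<close> is
  non-decreasing, the upward closure of \<open>K\<close> adds nothing outside \<open>{f > t}\<close>.\<close>

lemma level_set_approx:
  assumes f: "incr_bdd_M f" "f \<in> borel_measurable (Mmeas_on A)" and A: "A \<in> sets borel"
    and e: "e > 0"
  shows "\<exists>m u C. lip_incr m u \<and> (\<forall>i. C i \<in> sets borel \<and> bounded (C i) \<and> C i \<subseteq> A) \<and>
    (\<integral>\<omega>. \<bar>(if t < f (M \<omega>) then 1 else 0) - u (\<lambda>i. measure (M \<omega>) (C i))\<bar> \<partial>P) < e"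
proof -
  obtain \<nu> :: "'a measure" where \<nu>: "finite_measure \<nu>" "sets \<nu> = sets borel"
    "\<And>B. B \<in> sets borel \<Longrightarrow> measure \<nu> B = 0 \<Longrightarrow> AE \<omega> in P. emeasure (M \<omega>) B = 0"
    using control_measure by blast
  obtain L :: "nat \<Rightarrow> 'a set" where L: "\<And>k. compact (L k)" "\<And>k. L k \<subseteq> A" "disjoint_family L"
    "\<And>R k. R \<in> generated_ring \<Longrightarrow> closed (R \<inter> L k)" "measure \<nu> (A - (\<Union>k. L k)) = 0"
    using compact_exhaustion_making_closed[OF \<nu>(1,2) countable_ring _ _ A] generated_ring_empty ring_borel
    by (metis empty_iff subsetI)
  interpret compact_pieces I L
    by unfold_locales (use L in auto)
  have [measurable]: "f \<in> borel_measurable Mmeas" using f(1) by (simp add: incr_bdd_M_def)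
  have f_mono: "f \<mu> \<le> f \<mu>'" if "\<mu> \<in> Mspace" "\<mu>' \<in> Mspace" "meas_le \<mu> \<mu>'" for \<mu> \<mu>'
    using f(1) that by (auto simp: incr_bdd_M_def)
  define X where "X \<omega> = code (M \<omega>)" for \<omega>
  have X_meas [measurable]: "X \<in> borel_measurable P"
    unfolding X_def code_def using vec_M_measurable[OF coord_borel] by simp
  have X_eq: "X \<omega> = (\<lambda>i. measure (M \<omega>) (coord i))" for \<omega>
    by (simp add: X_def code_def fun_eq_iff)
  define E where "E = {x \<in> codes. t < f (decode x)}"
  have E: "E \<in> sets borel"
  proof -
    have [measurable]: "(\<lambda>x. f (decode x)) \<in> borel_measurable borel" by measurable
    have "E = codes \<inter> {x \<in> space borel. t < f (decode x)}" by (auto simp: E_def)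
    also have "\<dots> \<in> sets borel" by measurable
    finally show ?thesis .
  qed
  \<comment> \<open>The decoded code is the restriction of M to the union of the pieces. Off a null
    event it agrees with M on all Borel subsets of A, which is all that f can see.\<close>
  have ae: "AE \<omega> in P. f (decode (X \<omega>)) = f (M \<omega>)"
  proof -
    have "A - (\<Union>k. L k) \<in> sets borel" using A L_borel by auto
    from \<nu>(3)[OF this L(5)] show ?thesis
    proof (rule AE_mp, intro AE_I2 impI)
      fix \<omega> assume \<omega>: "\<omega> \<in> space P" "emeasure (M \<omega>) (A - (\<Union>k. L k)) = 0"
      note M = M_Mspace[OF \<omega>(1)]
      show "f (decode (X \<omega>)) = f (M \<omega>)"
      proof (rule Mmeas_on_cong[OF f(2) decode_Mspace M])
        fix B assume B: "B \<in> sets borel" "B \<subseteq> A"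
        have "B - (\<Union>k. L k) \<in> null_sets (M \<omega>)"
        proof (rule null_sets_subset)
          show "A - (\<Union>k. L k) \<in> null_sets (M \<omega>)"
            using \<omega>(2) A L_borel by (auto simp: null_sets_def Mspace_sets[OF M])
        qed (use B L_borel in \<open>auto simp: Mspace_sets[OF M]\<close>)
        then have "emeasure (M \<omega>) (B - (B - (\<Union>k. L k))) = emeasure (M \<omega>) B"
          using B by (intro emeasure_Diff_null_set) (auto simp: Mspace_sets[OF M])
        also have "B - (B - (\<Union>k. L k)) = B \<inter> (\<Union>k. L k)" by blast
        finally show "emeasure (decode (X \<omega>)) B = emeasure (M \<omega>) B"
          by (simp add: X_def decode_eq[OF M B(1)])
      qed
    qed
  qed
  define Q where "Q = distr P borel X"
  have Q: "finite_measure Q" "sets Q = sets borel"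
    unfolding Q_def using finite_measure_distr[OF X_meas] by auto
  obtain K where K: "compact K" "K \<subseteq> E" "measure Q (E - K) < e"
    using finite_measure_compact_subset[OF Q E e] .
  have EK [measurable]: "E - K \<in> sets borel" using E K(1) by (auto intro: borel_compact)
  define ind where "ind \<omega> = (if t < f (M \<omega>) then 1 else 0 :: real)" for \<omega>
  have [measurable]: "ind \<in> borel_measurable P" unfolding ind_def by measurable
  define up where "up \<omega> = (if \<exists>y\<in>K. \<forall>i. y i \<le> X \<omega> i then 1 else 0 :: real)" for \<omega>
  have hull_meas [measurable]: "(\<lambda>\<omega>. hull_fun K m (X \<omega>)) \<in> borel_measurable P" for m
    using measurable_compose[OF X_meas lip_incr_measurable[OF hull_fun_lip_incr]] .
  have lim: "(\<lambda>m. hull_fun K m (X \<omega>)) \<longlonglongrightarrow> up \<omega>" for \<omega>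
    unfolding up_def by (rule hull_fun_tendsto[OF K(1)])
  have [measurable]: "up \<in> borel_measurable P"
    by (rule borel_measurable_LIMSEQ_real[OF lim hull_meas])
  have "(\<lambda>m. \<integral>\<omega>. \<bar>ind \<omega> - hull_fun K m (X \<omega>)\<bar> \<partial>P) \<longlonglongrightarrow> (\<integral>\<omega>. \<bar>ind \<omega> - up \<omega>\<bar> \<partial>P)"
  proof (rule integral_dominated_convergence[where w = "\<lambda>_. 1"])
    show "AE \<omega> in P. (\<lambda>m. \<bar>ind \<omega> - hull_fun K m (X \<omega>)\<bar>) \<longlonglongrightarrow> \<bar>ind \<omega> - up \<omega>\<bar>"
      by (intro AE_I2 tendsto_intros lim)
    have "\<bar>ind \<omega> - hull_fun K m (X \<omega>)\<bar> \<le> 1" for m \<omega>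
      using lip_incr_range[OF hull_fun_lip_incr[of m K], of "X \<omega>"] by (auto simp: ind_def)
    then show "AE \<omega> in P. norm \<bar>ind \<omega> - hull_fun K m (X \<omega>)\<bar> \<le> 1" for m by simp
  qed auto
  moreover have "(\<integral>\<omega>. \<bar>ind \<omega> - up \<omega>\<bar> \<partial>P) < e"
  proof -
    \<comment> \<open>Almost surely the two indicators differ only if X lies in
      \<open>E - K\<close>: if an element of K is below X, monotonicity puts M in the level set; if
      none is, X itself is not in K.\<close>
    have "(\<integral>\<omega>. \<bar>ind \<omega> - up \<omega>\<bar> \<partial>P) \<le> (\<integral>\<omega>. indicator (E - K) (X \<omega>) \<partial>P)"
    proof (rule integral_mono_AE)
      show "integrable P (\<lambda>\<omega>. \<bar>ind \<omega> - up \<omega>\<bar>)"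
      proof (rule integrable_const_bound[where B = 1])
        show "AE \<omega> in P. norm \<bar>ind \<omega> - up \<omega>\<bar> \<le> 1" by (simp add: ind_def up_def)
      qed measurable
      show "integrable P (\<lambda>\<omega>. indicator (E - K) (X \<omega>) :: real)"
      proof (rule integrable_const_bound[where B = 1])
        show "(\<lambda>\<omega>. indicator (E - K) (X \<omega>) :: real) \<in> borel_measurable P" by measurable
      qed (simp add: indicator_def)
      show "AE \<omega> in P. \<bar>ind \<omega> - up \<omega>\<bar> \<le> indicator (E - K) (X \<omega>)"
        using ae
      proof (rule AE_mp, intro AE_I2 impI)
        fix \<omega> assume \<omega>: "\<omega> \<in> space P" "f (decode (X \<omega>)) = f (M \<omega>)"
        note M = M_Mspace[OF \<omega>(1)]
        show "\<bar>ind \<omega> - up \<omega>\<bar> \<le> indicator (E - K) (X \<omega>)"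
        proof (cases "\<exists>y\<in>K. \<forall>i. y i \<le> X \<omega> i")
          case True
          then obtain y where y: "y \<in> K" "\<And>i. y i \<le> X \<omega> i" by blast
          then have yE: "y \<in> codes" "t < f (decode y)" using K(2) by (auto simp: E_def)
          have "meas_le (decode y) (M \<omega>)"
            unfolding meas_le_def
          proof (intro ballI impI)
            fix B :: "'a set" assume B: "B \<in> sets borel"
            have "emeasure (decode y) B \<le> emeasure (M \<omega>) (B \<inter> (\<Union>k. L k))"
              using y(2) by (intro decode_le yE M B) (simp add: X_def)
            also have "\<dots> \<le> emeasure (M \<omega>) B"
              using B by (intro emeasure_mono) (auto simp: Mspace_sets[OF M])
            finally show "emeasure (decode y) B \<le> emeasure (M \<omega>) B" .
          qed
          from f_mono[OF decode_Mspace M this] yE(2) have "t < f (M \<omega>)" by simp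
          then show ?thesis using True by (simp add: ind_def up_def)
        next
          case False
          then have "X \<omega> \<notin> K" by auto
          moreover have "X \<omega> \<in> codes" unfolding X_def by (rule code_in_codes[OF M])
          ultimately show ?thesis using False \<omega>(2) by (auto simp: ind_def up_def E_def)
        qed
      qed
    qed
    also have "\<dots> = measure Q (E - K)"
    proof -
      have "(\<integral>\<omega>. indicator (E - K) (X \<omega>) \<partial>P) = (\<integral>x. indicator (E - K) x \<partial>Q :: real)"
        unfolding Q_def by (intro integral_distr[symmetric]) auto
      also have "\<dots> = measure Q (E - K)" using EK by (simp add: Q(2) sets_eq_imp_space_eq[OF Q(2)])
      finally show ?thesis .
    qed
    finally show ?thesis using K(3) by simp
  qed
  ultimately have "\<forall>\<^sub>F m in sequentially. (\<integral>\<omega>. \<bar>ind \<omega> - hull_fun K m (X \<omega>)\<bar> \<partial>P) < e"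
    by (intro order_tendstoD)
  then obtain m where "(\<integral>\<omega>. \<bar>ind \<omega> - hull_fun K m (X \<omega>)\<bar> \<partial>P) < e"
    by (auto simp: eventually_sequentially)
  moreover have "coord i \<subseteq> A" for i using coord_subset L(2) by blast
  ultimately show ?thesis
    unfolding X_eq ind_def
    using hull_fun_lip_incr[of m K] coord_borel coord_bounded by blast
qed

end

subsection \<open>Covariances\<close>

context prob_space
begin

definition cov :: "('a \<Rightarrow> real) \<Rightarrow> ('a \<Rightarrow> real) \<Rightarrow> real" where
  "cov X Y = expectation (\<lambda>\<omega>. X \<omega> * Y \<omega>) - expectation X * expectation Y"

definition unit_rv :: "('a \<Rightarrow> real) \<Rightarrow> bool" where
  "unit_rv X \<longleftrightarrow> X \<in> borel_measurable M \<and> (\<forall>\<omega>. 0 \<le> X \<omega> \<and> X \<omega> \<le> 1)"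

lemma integrable_unit_rv: "unit_rv X \<Longrightarrow> integrable M X"
  by (rule integrable_const_bound[where B = 1]) (auto simp: unit_rv_def)

lemma unit_rv_mult: "unit_rv X \<Longrightarrow> unit_rv Y \<Longrightarrow> unit_rv (\<lambda>\<omega>. X \<omega> * Y \<omega>)"
  by (auto simp: unit_rv_def mult_le_one)

lemma expectation_unit_rv: "unit_rv X \<Longrightarrow> 0 \<le> expectation X" "unit_rv X \<Longrightarrow> expectation X \<le> 1"
  using integral_mono[OF integrable_unit_rv, of X "\<lambda>_. 1"]
  by (auto simp: unit_rv_def prob_space intro!: Bochner_Integration.integral_nonneg)

text \<open>The splitting XY - X'Y' = X(Y - Y') + (X - X')Y' is used twice, under the expectation
  and for the product of expectations; each use costs 2e.\<close>

lemma cov_diff_le: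
  assumes "unit_rv X" "unit_rv Y" "unit_rv X'" "unit_rv Y'"
    and X: "expectation (\<lambda>\<omega>. \<bar>X \<omega> - X' \<omega>\<bar>) \<le> e" and Y: "expectation (\<lambda>\<omega>. \<bar>Y \<omega> - Y' \<omega>\<bar>) \<le> e"
  shows "\<bar>cov X Y - cov X' Y'\<bar> \<le> 4 * e"
proof -
  note int = integrable_unit_rv[OF assms(1)] integrable_unit_rv[OF assms(2)]
    integrable_unit_rv[OF assms(3)] integrable_unit_rv[OF assms(4)]
    integrable_unit_rv[OF unit_rv_mult[OF assms(1,2)]] integrable_unit_rv[OF unit_rv_mult[OF assms(3,4)]]
  have diff: "\<bar>expectation Z - expectation Z'\<bar> \<le> expectation (\<lambda>\<omega>. \<bar>Z \<omega> - Z' \<omega>\<bar>)"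
    if "integrable M Z" "integrable M Z'" for Z Z' :: "'a \<Rightarrow> real"
    using integral_abs_bound[of M "\<lambda>\<omega>. Z \<omega> - Z' \<omega>"] that by simp
  have "\<bar>expectation (\<lambda>\<omega>. X \<omega> * Y \<omega>) - expectation (\<lambda>\<omega>. X' \<omega> * Y' \<omega>)\<bar>
      \<le> expectation (\<lambda>\<omega>. \<bar>X \<omega> * Y \<omega> - X' \<omega> * Y' \<omega>\<bar>)"
    by (rule diff[OF int(5,6)])
  also have "\<dots> \<le> expectation (\<lambda>\<omega>. \<bar>X \<omega> - X' \<omega>\<bar> + \<bar>Y \<omega> - Y' \<omega>\<bar>)"
  proof (rule integral_mono)
    fix \<omega>
    have "\<bar>X \<omega> * Y \<omega> - X' \<omega> * Y' \<omega>\<bar> = \<bar>X \<omega> * (Y \<omega> - Y' \<omega>) + (X \<omega> - X' \<omega>) * Y' \<omega>\<bar>"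
      by (simp add: algebra_simps)
    also have "\<dots> \<le> \<bar>X \<omega>\<bar> * \<bar>Y \<omega> - Y' \<omega>\<bar> + \<bar>X \<omega> - X' \<omega>\<bar> * \<bar>Y' \<omega>\<bar>"
      by (rule order_trans[OF abs_triangle_ineq]) (simp add: abs_mult)
    also have "\<dots> \<le> 1 * \<bar>Y \<omega> - Y' \<omega>\<bar> + \<bar>X \<omega> - X' \<omega>\<bar> * 1"
      using assms(1,4) by (intro add_mono mult_right_mono mult_left_mono) (auto simp: unit_rv_def)
    finally show "\<bar>X \<omega> * Y \<omega> - X' \<omega> * Y' \<omega>\<bar> \<le> \<bar>X \<omega> - X' \<omega>\<bar> + \<bar>Y \<omega> - Y' \<omega>\<bar>" by simp
  qed (use int in auto)
  also have "\<dots> \<le> 2 * e" using int X Y by simp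
  finally have 1: "\<bar>expectation (\<lambda>\<omega>. X \<omega> * Y \<omega>) - expectation (\<lambda>\<omega>. X' \<omega> * Y' \<omega>)\<bar> \<le> 2 * e" .
  have dX: "\<bar>expectation X - expectation X'\<bar> \<le> e" using diff[OF int(1,3)] X by simp
  have dY: "\<bar>expectation Y - expectation Y'\<bar> \<le> e" using diff[OF int(2,4)] Y by simp
  have "\<bar>expectation X * expectation Y - expectation X' * expectation Y'\<bar> =
      \<bar>expectation X * (expectation Y - expectation Y') + (expectation X - expectation X') * expectation Y'\<bar>"
    by (simp add: algebra_simps)
  also have "\<dots> \<le> \<bar>expectation X\<bar> * \<bar>expectation Y - expectation Y'\<bar> +
      \<bar>expectation X - expectation X'\<bar> * \<bar>expectation Y'\<bar>"
    by (rule order_trans[OF abs_triangle_ineq]) (simp add: abs_mult)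
  also have "\<dots> \<le> 1 * e + e * 1"
    using assms(1,4) dX dY expectation_unit_rv[of X] expectation_unit_rv[of Y']
    by (intro add_mono mult_mono) auto
  finally show ?thesis using 1 unfolding cov_def by linarith
qed

text \<open>The covariance is continuous for L1 convergence of variables with values in [0,1], so
  either sign passes to the limit.\<close>

lemma cov_sign_limit:
  assumes XY: "unit_rv X" "unit_rv Y" and s: "\<bar>s\<bar> \<le> 1"
    and approx: "\<And>e. e > 0 \<Longrightarrow> \<exists>X' Y'. unit_rv X' \<and> unit_rv Y' \<and>
      expectation (\<lambda>\<omega>. \<bar>X \<omega> - X' \<omega>\<bar>) \<le> e \<and> expectation (\<lambda>\<omega>. \<bar>Y \<omega> - Y' \<omega>\<bar>) \<le> e \<and> 0 \<le> s * cov X' Y'"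
  shows "0 \<le> s * cov X Y"
proof (rule field_le_epsilon)
  fix e :: real assume "e > 0"
  then obtain X' Y' where *: "unit_rv X'" "unit_rv Y'" "0 \<le> s * cov X' Y'"
    "expectation (\<lambda>\<omega>. \<bar>X \<omega> - X' \<omega>\<bar>) \<le> e / 4" "expectation (\<lambda>\<omega>. \<bar>Y \<omega> - Y' \<omega>\<bar>) \<le> e / 4"
    using approx[of "e / 4"] by auto
  have "\<bar>s * cov X Y - s * cov X' Y'\<bar> = \<bar>s\<bar> * \<bar>cov X Y - cov X' Y'\<bar>"
    by (simp add: abs_mult right_diff_distrib[symmetric])
  also have "\<dots> \<le> 1 * (4 * (e / 4))"
    using cov_diff_le[OF XY *(1,2,4,5)] s by (intro mult_mono) auto
  finally show "0 \<le> s * cov X Y + e" using *(3) by simp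
qed

text \<open>The levels k/n below x are those with k less than the ceiling of nx, so S is that
  ceiling divided by n.\<close>

lemma layer_count:
  fixes x :: real
  assumes "0 \<le> x" "x \<le> 1" "n > 0"
  defines "S \<equiv> (\<Sum>k<n. 1 / real n * (if real k / real n < x then 1 else 0))"
  shows "\<bar>x - S\<bar> \<le> 1 / real n" "0 \<le> S" "S \<le> 1"
proof -
  have "k < nat \<lceil>real n * x\<rceil> \<longleftrightarrow> k < n \<and> real k / real n < x" for k
  proof -
    have "real n * x \<le> real n" using assms by (simp add: mult_left_le)
    then have "\<lceil>real n * x\<rceil> \<le> int n" by (simp add: ceiling_le_iff)
    moreover have "int k < \<lceil>real n * x\<rceil> \<longleftrightarrow> real k / real n < x"
      using assms(3) by (simp add: less_ceiling_iff field_simps)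
    ultimately show ?thesis by linarith
  qed
  then have "{k. k < n \<and> real k / real n < x} = {..<nat \<lceil>real n * x\<rceil>}" by auto
  moreover have "S = (\<Sum>k | k < n \<and> real k / real n < x. 1 / real n)"
    unfolding S_def by (intro sum.mono_neutral_cong_right) auto
  ultimately have S: "S = real_of_int \<lceil>real n * x\<rceil> / real n"
    using assms(1) by (simp add: of_nat_nat)
  have n: "real n * x \<le> real n" using assms by (simp add: mult_left_le)
  have c: "real n * x \<le> real_of_int \<lceil>real n * x\<rceil>" "real_of_int \<lceil>real n * x\<rceil> < real n * x + 1"
    by linarith+
  have c1: "\<lceil>real n * x\<rceil> \<le> int n" using n by (simp add: ceiling_le_iff)
  have "x - S = (real n * x - real_of_int \<lceil>real n * x\<rceil>) / real n"
    using assms(3) by (simp add: S field_simps)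
  then show "\<bar>x - S\<bar> \<le> 1 / real n" using c by (simp add: divide_right_mono)
  show "0 \<le> S" unfolding S_def by (intro sum_nonneg) auto
  show "S \<le> 1" unfolding S using c1 assms(3) by (simp add: divide_le_eq_1)
qed

lemma cov_double_sum:
  assumes "\<And>k. k \<in> K \<Longrightarrow> unit_rv (X k)" "\<And>l. l \<in> K \<Longrightarrow> unit_rv (Y l)"
  shows "cov (\<lambda>\<omega>. \<Sum>k\<in>K. a * X k \<omega>) (\<lambda>\<omega>. \<Sum>l\<in>K. b * Y l \<omega>) =
    (\<Sum>k\<in>K. \<Sum>l\<in>K. a * b * cov (X k) (Y l))"
proof -
  have iX: "k \<in> K \<Longrightarrow> integrable M (X k)" and iY: "k \<in> K \<Longrightarrow> integrable M (Y k)" for k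
    using assms integrable_unit_rv by auto
  have iXY: "integrable M (\<lambda>\<omega>. X k \<omega> * Y l \<omega>)" if "k \<in> K" "l \<in> K" for k l
    using integrable_unit_rv[OF unit_rv_mult] assms that by auto
  have "expectation (\<lambda>\<omega>. (\<Sum>k\<in>K. a * X k \<omega>) * (\<Sum>l\<in>K. b * Y l \<omega>)) =
      expectation (\<lambda>\<omega>. \<Sum>k\<in>K. \<Sum>l\<in>K. a * b * (X k \<omega> * Y l \<omega>))"
    by (simp add: sum_product mult_ac)
  also have "\<dots> = (\<Sum>k\<in>K. \<Sum>l\<in>K. a * b * expectation (\<lambda>\<omega>. X k \<omega> * Y l \<omega>))"
    using iXY by (subst Bochner_Integration.integral_sum; simp)+
  finally have 1: "expectation (\<lambda>\<omega>. (\<Sum>k\<in>K. a * X k \<omega>) * (\<Sum>l\<in>K. b * Y l \<omega>)) =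
      (\<Sum>k\<in>K. \<Sum>l\<in>K. a * b * expectation (\<lambda>\<omega>. X k \<omega> * Y l \<omega>))" .
  have 2: "expectation (\<lambda>\<omega>. \<Sum>k\<in>K. a * X k \<omega>) = (\<Sum>k\<in>K. a * expectation (X k))"
    "expectation (\<lambda>\<omega>. \<Sum>k\<in>K. b * Y k \<omega>) = (\<Sum>k\<in>K. b * expectation (Y k))"
    using iX iY by simp_all
  show ?thesis
    unfolding cov_def 1 2
    by (simp add: sum_product sum_subtractf[symmetric] algebra_simps)
qed

text \<open>A discrete form of Hoeffding's covariance identity: by bilinearity the covariance of two
  layer sums is a combination, with non-negative weights, of covariances of indicators of level
  sets.\<close>

lemma cov_sign_layers_unit:
  assumes XY: "unit_rv X" "unit_rv Y" and s: "\<bar>s\<bar> \<le> 1"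
    and lev: "\<And>t r. 0 \<le> s * cov (\<lambda>\<omega>. if t < X \<omega> then 1 else 0) (\<lambda>\<omega>. if r < Y \<omega> then 1 else 0)"
  shows "0 \<le> s * cov X Y"
proof (rule cov_sign_limit[OF XY s])
  fix e :: real assume "e > 0"
  then obtain n :: nat where n: "n > 0" "1 / real n < e"
    using nat_approx_posE by (metis zero_less_Suc)
  define S where "S Z \<omega> = (\<Sum>k<n. 1 / real n * (if real k / real n < Z \<omega> then 1 else 0))"
    for Z :: "'a \<Rightarrow> real" and \<omega>
  have ind: "unit_rv (\<lambda>\<omega>. if t < Z \<omega> then 1 else 0)" if "unit_rv Z" for Z t
  proof -
    have [measurable]: "Z \<in> borel_measurable M" using that by (simp add: unit_rv_def)
    show ?thesis by (auto simp: unit_rv_def)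
  qed
  have S: "unit_rv (S Z)" "expectation (\<lambda>\<omega>. \<bar>Z \<omega> - S Z \<omega>\<bar>) \<le> e" if Z: "unit_rv Z" for Z
  proof -
    have [measurable]: "Z \<in> borel_measurable M" using Z by (simp add: unit_rv_def)
    have lc: "\<bar>Z \<omega> - S Z \<omega>\<bar> \<le> 1 / real n" "0 \<le> S Z \<omega>" "S Z \<omega> \<le> 1" for \<omega>
      using layer_count[of "Z \<omega>" n] Z n(1) unfolding S_def by (auto simp: unit_rv_def)
    show SZ: "unit_rv (S Z)" unfolding unit_rv_def using lc by (auto simp: S_def[abs_def])
    have "expectation (\<lambda>\<omega>. \<bar>Z \<omega> - S Z \<omega>\<bar>) \<le> expectation (\<lambda>\<omega>. 1 / real n)"
      using lc integrable_unit_rv[OF Z] integrable_unit_rv[OF SZ] by (intro integral_mono) auto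
    then show "expectation (\<lambda>\<omega>. \<bar>Z \<omega> - S Z \<omega>\<bar>) \<le> e" using n(2) by (simp add: prob_space)
  qed
  have "0 \<le> s * cov (S X) (S Y)"
  proof -
    have "s * cov (S X) (S Y) = s * (\<Sum>k<n. \<Sum>l<n. 1 / real n * (1 / real n) *
        cov (\<lambda>\<omega>. if real k / real n < X \<omega> then 1 else 0) (\<lambda>\<omega>. if real l / real n < Y \<omega> then 1 else 0))"
      unfolding S_def[abs_def] using ind[OF XY(1)] ind[OF XY(2)]
      by (intro arg_cong[where f = "\<lambda>x. s * x"] cov_double_sum)
    also have "\<dots> = (\<Sum>k<n. \<Sum>l<n. 1 / real n * (1 / real n) *
        (s * cov (\<lambda>\<omega>. if real k / real n < X \<omega> then 1 else 0) (\<lambda>\<omega>. if real l / real n < Y \<omega> then 1 else 0)))"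
      by (simp add: sum_distrib_left mult_ac)
    also have "\<dots> \<ge> 0" by (intro sum_nonneg mult_nonneg_nonneg lev) auto
    finally show ?thesis .
  qed
  then show "\<exists>X' Y'. unit_rv X' \<and> unit_rv Y' \<and>
      expectation (\<lambda>\<omega>. \<bar>X \<omega> - X' \<omega>\<bar>) \<le> e \<and> expectation (\<lambda>\<omega>. \<bar>Y \<omega> - Y' \<omega>\<bar>) \<le> e \<and> 0 \<le> s * cov X' Y'"
    using S XY by blast
qed

lemma cov_affine:
  assumes "integrable M X" "integrable M Y" "integrable M (\<lambda>\<omega>. X \<omega> * Y \<omega>)"
  shows "cov (\<lambda>\<omega>. a * X \<omega> + b) (\<lambda>\<omega>. a * Y \<omega> + b) = a\<^sup>2 * cov X Y"
proof -
  have "expectation (\<lambda>\<omega>. (a * X \<omega> + b) * (a * Y \<omega> + b)) =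
      expectation (\<lambda>\<omega>. a\<^sup>2 * (X \<omega> * Y \<omega>) + a * b * X \<omega> + a * b * Y \<omega> + b * b)"
    by (simp add: algebra_simps power2_eq_square)
  also have "\<dots> = a\<^sup>2 * expectation (\<lambda>\<omega>. X \<omega> * Y \<omega>) + a * b * expectation X + a * b * expectation Y + b * b"
    using assms by (simp add: prob_space)
  finally show ?thesis
    using assms by (simp add: cov_def prob_space algebra_simps power2_eq_square)
qed

text \<open>An increasing affine map moves the values into [0,1]; it only relabels the levels and
  multiplies the covariance by a positive square.\<close>

lemma cov_sign_layers:
  assumes X: "X \<in> borel_measurable M" "\<And>\<omega>. \<omega> \<in> space M \<Longrightarrow> \<bar>X \<omega>\<bar> \<le> C"
    and Y: "Y \<in> borel_measurable M" "\<And>\<omega>. \<omega> \<in> space M \<Longrightarrow> \<bar>Y \<omega>\<bar> \<le> C" and s: "\<bar>s\<bar> \<le> 1"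
    and lev: "\<And>t r. 0 \<le> s * cov (\<lambda>\<omega>. if t < X \<omega> then 1 else 0) (\<lambda>\<omega>. if r < Y \<omega> then 1 else 0)"
  shows "0 \<le> s * cov X Y"
proof -
  note [measurable] = X(1) Y(1)
  obtain \<omega>0 where "\<omega>0 \<in> space M" using not_empty by blast
  then have C: "C \<ge> 0" using X(2)[of \<omega>0] by linarith
  \<comment> \<open>C + 1 avoids division by zero for C = 0, and \<open>a * C \<le> 1/2\<close>
    keeps the shifted values in [0,1].\<close>
  define a where "a = 1 / (2 * (C + 1))"
  have a: "a > 0" using C by (simp add: a_def)
  have cong: "cov Z W = cov Z' W'"
    if "\<And>\<omega>. \<omega> \<in> space M \<Longrightarrow> Z \<omega> = Z' \<omega>" "\<And>\<omega>. \<omega> \<in> space M \<Longrightarrow> W \<omega> = W' \<omega>" for Z W Z' W'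
    unfolding cov_def using that by (simp cong: Bochner_Integration.integral_cong)
  \<comment> \<open>\<open>unit_rv\<close> asks for bounds at every point, whereas X and Y are
    bounded on the sample space only. The truncation takes effect outside that space.\<close>
  define T where "T Z \<omega> = max 0 (min 1 (a * Z \<omega> + 1/2))" for Z :: "'a \<Rightarrow> real" and \<omega>
  have T: "T Z \<omega> = a * Z \<omega> + 1/2" if "\<bar>Z \<omega>\<bar> \<le> C" for Z \<omega>
  proof -
    have "a * \<bar>Z \<omega>\<bar> \<le> a * (C + 1)" using that a by (intro mult_left_mono) auto
    also have "\<dots> = 1/2" using C by (simp add: a_def)
    finally have "\<bar>a * Z \<omega>\<bar> \<le> 1/2" using a by (simp add: abs_mult)
    then show ?thesis unfolding T_def by linarith
  qed
  have unit: "unit_rv (T X)" "unit_rv (T Y)" by (auto simp: unit_rv_def T_def[abs_def])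
  have lev_T: "(t < T Z \<omega>) = ((t - 1/2) / a < Z \<omega>)" if "\<bar>Z \<omega>\<bar> \<le> C" for Z t \<omega>
    using a by (simp add: T[of Z \<omega>, OF that] pos_divide_less_eq mult.commute[of a] less_diff_eq diff_less_eq)
  have "0 \<le> s * cov (T X) (T Y)"
  proof (rule cov_sign_layers_unit[OF unit s])
    fix t r
    have "cov (\<lambda>\<omega>. if t < T X \<omega> then 1 else 0) (\<lambda>\<omega>. if r < T Y \<omega> then 1 else 0) =
        cov (\<lambda>\<omega>. if (t - 1/2) / a < X \<omega> then 1 else 0) (\<lambda>\<omega>. if (r - 1/2) / a < Y \<omega> then 1 else 0)"
      using X(2) Y(2) by (intro cong) (auto simp only: lev_T)
    then show "0 \<le> s * cov (\<lambda>\<omega>. if t < T X \<omega> then 1 else 0) (\<lambda>\<omega>. if r < T Y \<omega> then 1 else 0)"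
      using lev by simp
  qed
  also have "cov (T X) (T Y) = cov (\<lambda>\<omega>. a * X \<omega> + 1/2) (\<lambda>\<omega>. a * Y \<omega> + 1/2)"
    using X(2) Y(2) by (intro cong T)
  also have "\<dots> = a\<^sup>2 * cov X Y"
  proof (rule cov_affine)
    show "integrable M X" using X by (intro integrable_const_bound[where B = C]) auto
    show "integrable M Y" using Y by (intro integrable_const_bound[where B = C]) auto
    have "\<bar>X \<omega> * Y \<omega>\<bar> \<le> C * C" if "\<omega> \<in> space M" for \<omega>
      unfolding abs_mult using X(2)[OF that] Y(2)[OF that] C by (intro mult_mono) auto
    then show "integrable M (\<lambda>\<omega>. X \<omega> * Y \<omega>)"
      by (intro integrable_const_bound[where B = "C * C"]) auto
  qed
  finally have "0 \<le> a\<^sup>2 * (s * cov X Y)" by (simp add: mult.left_commute)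
  then show ?thesis using a by (simp add: zero_le_mult_iff)
qed

end

subsection \<open>Reduction to vectors\<close>

context dissecting_semiring
begin

text \<open>The atoms of the finite family F are ring sets, and each is a finite disjoint union of
  semi-ring sets. These blocks together are disjoint, and every member of F is the union of the
  blocks it contains.\<close>

lemma ring_refinement:
  assumes F: "finite F" "F \<subseteq> generated_ring"
  shows "\<exists>(n::nat) B. n \<ge> 1 \<and> (\<forall>i<n. B i \<in> I) \<and> disjoint_family_on B {..<n} \<and>
    (\<forall>R\<in>F. R = (\<Union>i\<in>{i. i < n \<and> B i \<noteq> {} \<and> B i \<subseteq> R}. B i))"
proof -
  \<comment> \<open>The empty subfamily is left out: its atom is the complement of the union of F,
    which need not be in the ring.\<close>
  define S where "S = Pow F - {{}}"
  define atom where "atom s = \<Inter>s - \<Union>(F - s)" for s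
  have "atom s \<in> generated_ring" if "s \<in> S" for s
    unfolding atom_def
  proof (rule ring.Diff)
    show "\<Inter>s \<in> generated_ring"
      using that F finite_subset[of s F] by (intro generated_ring_Inter) (auto simp: S_def)
    show "\<Union>(F - s) \<in> generated_ring" using F by (intro ring.finite_Union) auto
  qed
  then have "\<forall>s\<in>S. \<exists>T. finite T \<and> disjoint T \<and> T \<subseteq> I \<and> atom s = \<Union>T"
    by (meson generated_ringE)
  then obtain T where T: "\<And>s. s \<in> S \<Longrightarrow> finite (T s)" "\<And>s. s \<in> S \<Longrightarrow> disjoint (T s)"
    "\<And>s. s \<in> S \<Longrightarrow> T s \<subseteq> I" "\<And>s. s \<in> S \<Longrightarrow> atom s = \<Union>(T s)"
    by metis
  \<comment> \<open>The empty block guarantees \<open>n \<ge> 1\<close> even when no atom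
    contributes a block.\<close>
  define U where "U = insert {} (\<Union>s\<in>S. T s)"
  have finU: "finite U" using F(1) T(1) by (auto simp: U_def S_def)
  have UI: "U \<subseteq> I" using T(3) by (auto simp: U_def)
  have "disjoint_family_on (\<lambda>s. \<Union>(T s)) S"
    unfolding disjoint_family_on_def
  proof (intro ballI impI)
    fix s s' assume s: "s \<in> S" "s' \<in> S" "s \<noteq> s'"
    then have "atom s \<inter> atom s' = {}" unfolding atom_def S_def by blast
    then show "\<Union>(T s) \<inter> \<Union>(T s') = {}" using T(4) s by simp
  qed
  then have "disjoint (\<Union>s\<in>S. T s)" using T(2) by (intro disjoint_UN)
  then have disjU: "disjoint U" by (auto simp: U_def disjoint_def)
  obtain B where B: "bij_betw B {0..<card U} U" using ex_bij_betw_nat_finite[OF finU] by blast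
  define n where "n = card U"
  have img: "B ` {..<n} = U" and inj: "inj_on B {..<n}"
    using B by (auto simp: bij_betw_def n_def lessThan_atLeast0)
  show ?thesis
  proof (intro exI[of _ n] exI[of _ B] conjI allI impI ballI)
    show "n \<ge> 1" using finU by (auto simp: n_def U_def Suc_le_eq card_gt_0_iff)
    show "B i \<in> I" if "i < n" for i using img UI that by auto
    show "disjoint_family_on B {..<n}"
      unfolding disjoint_family_on_def
    proof (intro ballI impI)
      fix i j assume ij: "i \<in> {..<n}" "j \<in> {..<n}" "i \<noteq> j"
      then have "B i \<noteq> B j" using inj by (auto simp: inj_on_def)
      moreover have "B i \<in> U" "B j \<in> U" using img ij by auto
      ultimately show "B i \<inter> B j = {}" using disjU by (auto simp: disjoint_def)
    qed
    fix R assume R: "R \<in> F"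
    have "x \<in> (\<Union>i\<in>{i. i < n \<and> B i \<noteq> {} \<and> B i \<subseteq> R}. B i)" if x: "x \<in> R" for x
    proof -
      define s where "s = {Q \<in> F. x \<in> Q}"
      have s: "s \<in> S" "R \<in> s" using R x by (auto simp: s_def S_def)
      have "x \<in> atom s" by (auto simp: atom_def s_def)
      then obtain t where t: "t \<in> T s" "x \<in> t" using T(4)[OF s(1)] by auto
      have "t \<subseteq> atom s" using t(1) T(4)[OF s(1)] by auto
      also have "\<dots> \<subseteq> R" using s(2) by (auto simp: atom_def)
      finally have "t \<subseteq> R" .
      moreover have "t \<in> U" using t(1) s(1) by (auto simp: U_def)
      then obtain i where "i < n" "B i = t" using img by auto
      ultimately show ?thesis using t(2) by auto
    qed
    then show "R = (\<Union>i\<in>{i. i < n \<and> B i \<noteq> {} \<and> B i \<subseteq> R}. B i)" by auto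
  qed
qed

lemma measure_ring_sum:
  assumes "\<mu> \<in> Mspace" "\<And>i. i < n \<Longrightarrow> B i \<in> I" "disjoint_family_on B {..<n}"
    "S \<subseteq> {..<n :: nat}" "R = (\<Union>i\<in>S. B i)"
  shows "measure \<mu> R = (\<Sum>i\<in>S. measure \<mu> (B i))"
  unfolding assms(5)
proof (rule measure_UNION')
  show "finite S" by (rule finite_subset[OF assms(4)]) simp
  show "B i \<in> fmeasurable \<mu>" if "i \<in> S" for i
    using that assms(1,2,4) bdd by (intro Mspace_fmeasurable) auto
  show "pairwise (\<lambda>i j. disjnt (B i) (B j)) S"
    using assms(3,4) by (auto simp: pairwise_def disjnt_def disjoint_family_on_def)
qed

text \<open>Supplies the test functions for the implications from M to its vectors. Boundedness of
  the sets enters through \<open>measure\<close>, which sends an infinite value to 0 and is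
  therefore monotone only where the values are finite.\<close>

lemma vec_function_incr_bdd_M:
  assumes f: "incr_bdd_vec J f" and B: "\<And>j. j \<in> J \<Longrightarrow> B j \<in> I"
  shows "incr_bdd_M (\<lambda>\<mu>. f (\<lambda>j\<in>J. measure \<mu> (B j)))"
    and "(\<Union>j\<in>J. B j) \<subseteq> A \<Longrightarrow> (\<lambda>\<mu>. f (\<lambda>j\<in>J. measure \<mu> (B j))) \<in> borel_measurable (Mmeas_on A)"
proof -
  have meas: "(\<lambda>\<mu>. f (\<lambda>j\<in>J. measure \<mu> (B j))) \<in> borel_measurable (Mmeas_on A)"
    if "(\<Union>j\<in>J. B j) \<subseteq> A" for A
  proof (rule measurable_compose[where g = f])
    show "(\<lambda>\<mu>. \<lambda>j\<in>J. measure \<mu> (B j)) \<in> measurable (Mmeas_on A) (PiM J (\<lambda>_. borel))"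
      using that B bdd by (intro measurable_restrict measure_measurable_Mmeas_on) auto
    show "f \<in> borel_measurable (PiM J (\<lambda>_. borel))" using f by (simp add: incr_bdd_vec_def)
  qed
  then show "(\<Union>j\<in>J. B j) \<subseteq> A \<Longrightarrow>
    (\<lambda>\<mu>. f (\<lambda>j\<in>J. measure \<mu> (B j))) \<in> borel_measurable (Mmeas_on A)" .
  have sp: "(\<lambda>j\<in>J. measure \<mu> (B j)) \<in> space (PiM J (\<lambda>_. borel))" for \<mu>
    by (simp add: space_PiM)
  have mono: "measure \<mu> (B j) \<le> measure \<nu> (B j)"
    if "\<mu> \<in> Mspace" "\<nu> \<in> Mspace" "meas_le \<mu> \<nu>" "j \<in> J" for \<mu> \<nu> j
  proof -
    have "B j \<in> sets borel" "bounded (B j)" using B[OF that(4)] bdd by auto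
    then show ?thesis
      unfolding measure_def using that Mspace_finite[of \<nu> "B j"]
      by (intro enn2real_mono) (auto simp: meas_le_def)
  qed
  show "incr_bdd_M (\<lambda>\<mu>. f (\<lambda>j\<in>J. measure \<mu> (B j)))"
    unfolding incr_bdd_M_def
  proof (intro conjI ballI impI)
    show "(\<lambda>\<mu>. f (\<lambda>j\<in>J. measure \<mu> (B j))) \<in> borel_measurable Mmeas"
      unfolding Mmeas_def by (rule meas) simp
    obtain C where "\<forall>x\<in>space (PiM J (\<lambda>_. borel)). \<bar>f x\<bar> \<le> C"
      using f by (auto simp: incr_bdd_vec_def)
    then show "\<exists>C. \<forall>\<mu>\<in>Mspace. \<bar>f (\<lambda>j\<in>J. measure \<mu> (B j))\<bar> \<le> C" using sp by blast
    fix \<mu> \<nu> :: "'a measure" assume "\<mu> \<in> Mspace" "\<nu> \<in> Mspace" "meas_le \<mu> \<nu>"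
    then have "\<forall>j\<in>J. (\<lambda>j\<in>J. measure \<mu> (B j)) j \<le> (\<lambda>j\<in>J. measure \<nu> (B j)) j"
      using mono by simp
    then show "f (\<lambda>j\<in>J. measure \<mu> (B j)) \<le> f (\<lambda>j\<in>J. measure \<nu> (B j))"
      using f sp unfolding incr_bdd_vec_def by blast
  qed
qed

end

lemma lip_incr_sums_incr_bdd_vec:
  assumes u: "lip_incr m u" and S: "\<And>l. S l \<subseteq> J"
  shows "incr_bdd_vec J (\<lambda>x. u (\<lambda>l. \<Sum>i\<in>S l. x i))"
  unfolding incr_bdd_vec_def
proof (intro conjI ballI impI)
  show "(\<lambda>x. u (\<lambda>l. \<Sum>i\<in>S l. x i)) \<in> borel_measurable (PiM J (\<lambda>_. borel))"
  proof (rule measurable_compose[OF _ lip_incr_measurable[OF u]])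
    show "(\<lambda>(x :: nat \<Rightarrow> real) l. \<Sum>i\<in>S l. x i) \<in> borel_measurable (PiM J (\<lambda>_. borel))"
      using S by (intro measurable_coordinatewise_then_product borel_measurable_sum
          measurable_component_singleton) auto
  qed
  show "\<exists>C. \<forall>x\<in>space (PiM J (\<lambda>_. borel)). \<bar>u (\<lambda>l. \<Sum>i\<in>S l. x i)\<bar> \<le> C"
    using lip_incr_range[OF u] by (intro exI[of _ 1]) (auto simp: abs_le_iff intro: order_trans[of _ 0])
  show "u (\<lambda>l. \<Sum>i\<in>S l. x i) \<le> u (\<lambda>l. \<Sum>i\<in>S l. y i)" if "\<forall>j\<in>J. x j \<le> y j" for x y
    using that S by (intro lip_incr_mono[OF u] sum_mono) blast
qed

section \<open>From Borel sets to ring sets in mean truncated distance\<close>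

context random_measure_semiring
begin

lemma unit_rv_lip_incr:
  "lip_incr m u \<Longrightarrow> (\<And>i. C i \<in> sets borel) \<Longrightarrow> unit_rv (\<lambda>\<omega>. u (\<lambda>i. measure (M \<omega>) (C i)))"
  unfolding unit_rv_def
  using lip_incr_range measurable_compose[OF vec_M_measurable lip_incr_measurable] by blast

text \<open>The truncation makes this finite without integrability of M D and keeps monotonicity on
  bounded sets and subadditivity; it is small exactly when M D is small in probability.\<close>

definition rho :: "'a set \<Rightarrow> real" where
  "rho D = expectation (\<lambda>\<omega>. min 1 (measure (M \<omega>) D))"

lemma rho_integrable: "D \<in> sets borel \<Longrightarrow> integrable P (\<lambda>\<omega>. min 1 (measure (M \<omega>) D))"
  using measure_M_measurable[of D] by (intro integrable_const_bound[where B = 1]) auto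

lemma rho_mono:
  assumes "C \<in> sets borel" "D \<in> sets borel" "bounded D" "C \<subseteq> D" shows "rho C \<le> rho D"
  unfolding rho_def
proof (intro integral_mono rho_integrable assms)
  fix \<omega> assume "\<omega> \<in> space P"
  note M = M_Mspace[OF this]
  have "measure (M \<omega>) C \<le> measure (M \<omega>) D"
    using assms M by (intro measure_mono_fmeasurable Mspace_fmeasurable) (auto simp: Mspace_sets)
  then show "min 1 (measure (M \<omega>) C) \<le> min 1 (measure (M \<omega>) D)" by simp
qed

lemma rho_Un:
  assumes "C \<in> sets borel" "D \<in> sets borel" shows "rho (C \<union> D) \<le> rho C + rho D"
proof -
  have "rho (C \<union> D) \<le> expectation (\<lambda>\<omega>. min 1 (measure (M \<omega>) C) + min 1 (measure (M \<omega>) D))"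
    unfolding rho_def
  proof (intro integral_mono rho_integrable Bochner_Integration.integrable_add)
    fix \<omega> assume "\<omega> \<in> space P"
    note M = M_Mspace[OF this]
    have "measure (M \<omega>) (C \<union> D) \<le> measure (M \<omega>) C + measure (M \<omega>) D"
      using assms by (intro measure_Un_le) (auto simp: Mspace_sets[OF M])
    then show "min 1 (measure (M \<omega>) (C \<union> D)) \<le> min 1 (measure (M \<omega>) C) + min 1 (measure (M \<omega>) D)"
      using measure_nonneg[of "M \<omega>" C] measure_nonneg[of "M \<omega>" D] by linarith
  qed (use assms in auto)
  also have "\<dots> = rho C + rho D"
    unfolding rho_def using assms by (intro Bochner_Integration.integral_add rho_integrable)
  finally show ?thesis .
qed

lemma rho_empty: "rho {} = 0"
  by (simp add: rho_def)

lemma rho_UN: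
  fixes C :: "nat \<Rightarrow> 'a set"
  assumes "\<And>i. C i \<in> sets borel" shows "rho (\<Union>i<n. C i) \<le> (\<Sum>i<n. rho (C i))"
proof (induction n)
  case (Suc n)
  have "rho (\<Union>i<Suc n. C i) = rho ((\<Union>i<n. C i) \<union> C n)" by (simp add: lessThan_Suc Un_commute)
  also have "\<dots> \<le> rho (\<Union>i<n. C i) + rho (C n)" using assms by (intro rho_Un) auto
  finally show ?case using Suc by simp
qed (simp add: rho_empty)

text \<open>The continuity that \<open>ring_approx\<close> asks for comes from continuity from above
  of each M on bounded sets and dominated convergence with bound 1.\<close>

lemma rho_ring_approx:
  assumes C: "C \<in> sets borel" "bounded C" and e: "e > 0"
  shows "\<exists>R\<in>generated_ring. rho (sym_diff C R) < e"
proof -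
  obtain R0 where R0: "R0 \<in> generated_ring" "C \<subseteq> R0" using bounded_in_ring[OF C] .
  have "\<exists>R\<in>generated_ring. R \<subseteq> R0 \<and> rho (sym_diff (C \<inter> R0) R) < e"
  proof (rule ring_approx[where \<rho> = rho, OF R0(1) rho_empty _ _ _ C(1) e])
    show "rho B \<le> rho D" if "B \<in> sets borel" "D \<in> sets borel" "B \<subseteq> D" "D \<subseteq> R0" for B D
      using that bounded_subset[OF ring_bounded[OF R0(1)]] by (intro rho_mono)
    show "(\<lambda>n. rho (D n)) \<longlonglongrightarrow> 0"
      if D: "range D \<subseteq> sets borel" "\<And>n. D n \<subseteq> R0" "decseq D" "(\<Inter>n. D n) = {}" for D
    proof -
      have Db: "D n \<in> sets borel" "bounded (D n)" for n
        using D(1) bounded_subset[OF ring_bounded[OF R0(1)] D(2)] by auto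
      have "(\<lambda>n. rho (D n)) \<longlonglongrightarrow> expectation (\<lambda>\<omega>. 0)"
        unfolding rho_def
      proof (rule integral_dominated_convergence[where w = "\<lambda>_. 1"])
        show "(\<lambda>\<omega>. min 1 (measure (M \<omega>) (D n))) \<in> borel_measurable P" for n
          using measure_M_measurable[OF Db(1)] by measurable
        show "AE \<omega> in P. (\<lambda>n. min 1 (measure (M \<omega>) (D n))) \<longlonglongrightarrow> 0"
        proof (rule AE_I2)
          fix \<omega> assume "\<omega> \<in> space P"
          note M = M_Mspace[OF this]
          have "(\<lambda>n. measure (M \<omega>) (D n)) \<longlonglongrightarrow> measure (M \<omega>) (\<Inter>n. D n)"
            using D(1,3) Mspace_finite[OF M Db]
            by (intro Lim_measure_decseq) (auto simp: Mspace_sets[OF M] less_top)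
          then have "(\<lambda>n. measure (M \<omega>) (D n)) \<longlonglongrightarrow> 0" by (simp add: D(4))
          from tendsto_min[OF tendsto_const[of 1] this]
          show "(\<lambda>n. min 1 (measure (M \<omega>) (D n))) \<longlonglongrightarrow> 0" by simp
        qed
      qed auto
      then show ?thesis by simp
    qed
  qed (use rho_Un in auto)
  then show ?thesis using R0(2) by (auto simp: Int_absorb2)
qed

text \<open>The Lipschitz bound may be truncated coordinate by coordinate. If all differences are at
  most 1, nothing changes; if one exceeds 1, the truncated right side is already at least 1, which
  bounds any difference of values of u.\<close>

lemma lip_incr_rho:
  assumes u: "lip_incr m u"
    and C: "\<And>i. C i \<in> sets borel" "\<And>i. bounded (C i)"
    and C': "\<And>i. C' i \<in> sets borel" "\<And>i. bounded (C' i)"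
  shows "expectation (\<lambda>\<omega>. \<bar>u (\<lambda>i. measure (M \<omega>) (C i)) - u (\<lambda>i. measure (M \<omega>) (C' i))\<bar>)
    \<le> real m * (\<Sum>i<m. rho (sym_diff (C i) (C' i)))"
proof -
  have sd: "sym_diff (C i) (C' i) \<in> sets borel" "bounded (sym_diff (C i) (C' i))" for i
    using C C' by (auto intro: bounded_subset)
  have "expectation (\<lambda>\<omega>. \<bar>u (\<lambda>i. measure (M \<omega>) (C i)) - u (\<lambda>i. measure (M \<omega>) (C' i))\<bar>)
      \<le> expectation (\<lambda>\<omega>. real m * (\<Sum>i<m. min 1 (measure (M \<omega>) (sym_diff (C i) (C' i)))))"
  proof (rule integral_mono)
    show "integrable P (\<lambda>\<omega>. \<bar>u (\<lambda>i. measure (M \<omega>) (C i)) - u (\<lambda>i. measure (M \<omega>) (C' i))\<bar>)"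
      using integrable_unit_rv[OF unit_rv_lip_incr[OF u C(1)]]
        integrable_unit_rv[OF unit_rv_lip_incr[OF u C'(1)]] by auto
    show "integrable P (\<lambda>\<omega>. real m * (\<Sum>i<m. min 1 (measure (M \<omega>) (sym_diff (C i) (C' i)))))"
      by (intro integrable_mult_right Bochner_Integration.integrable_sum rho_integrable sd)
    fix \<omega> assume "\<omega> \<in> space P"
    note M = M_Mspace[OF this]
    define x y where "x = (\<lambda>i. measure (M \<omega>) (C i))" and "y = (\<lambda>i. measure (M \<omega>) (C' i))"
    have xy: "\<bar>x i - y i\<bar> \<le> measure (M \<omega>) (sym_diff (C i) (C' i))" for i
    proof -
      have le: "measure (M \<omega>) D \<le> measure (M \<omega>) D' + measure (M \<omega>) (sym_diff D D')"
        if D: "D \<in> sets borel" "D' \<in> sets borel" "bounded D" "bounded D'" for D D'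
      proof -
        have "bounded (D' \<union> sym_diff D D')" using D by (auto intro: bounded_subset)
        then have "measure (M \<omega>) D \<le> measure (M \<omega>) (D' \<union> sym_diff D D')"
          using D M by (intro measure_mono_fmeasurable Mspace_fmeasurable) (auto simp: Mspace_sets)
        also have "\<dots> \<le> measure (M \<omega>) D' + measure (M \<omega>) (sym_diff D D')"
          using D by (intro measure_Un_le) (auto simp: Mspace_sets[OF M])
        finally show ?thesis .
      qed
      have "sym_diff (C' i) (C i) = sym_diff (C i) (C' i)" by blast
      then show ?thesis
        using le[of "C i" "C' i"] le[of "C' i" "C i"] C C' by (simp add: x_def y_def abs_le_iff)
    qed
    have "\<bar>u x - u y\<bar> \<le> real m * (\<Sum>i<m. min 1 \<bar>x i - y i\<bar>)"
    proof (cases "\<forall>i<m. \<bar>x i - y i\<bar> \<le> 1")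
      case True
      then have "(\<Sum>i<m. min 1 \<bar>x i - y i\<bar>) = (\<Sum>i<m. \<bar>x i - y i\<bar>)"
        by (intro sum.cong) auto
      then show ?thesis using lip_incr_lip[OF u, of x y] by simp
    next
      case False
      then obtain j where j: "j < m" "\<bar>x j - y j\<bar> > 1" by auto
      have "\<bar>u x - u y\<bar> \<le> 1"
        using lip_incr_range[OF u, of x] lip_incr_range[OF u, of y] by auto
      also have "1 = min 1 \<bar>x j - y j\<bar>" using j by simp
      also have "\<dots> \<le> (\<Sum>i<m. min 1 \<bar>x i - y i\<bar>)"
        using j by (intro member_le_sum) auto
      also have "\<dots> \<le> real m * (\<Sum>i<m. min 1 \<bar>x i - y i\<bar>)"
        using j mult_right_mono[of 1 "real m" "\<Sum>i<m. min 1 \<bar>x i - y i\<bar>"]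
        by (auto simp: sum_nonneg)
      finally show ?thesis .
    qed
    also have "\<dots> \<le> real m * (\<Sum>i<m. min 1 (measure (M \<omega>) (sym_diff (C i) (C' i))))"
      using xy by (intro mult_left_mono sum_mono min.mono) auto
    finally show "\<bar>u (\<lambda>i. measure (M \<omega>) (C i)) - u (\<lambda>i. measure (M \<omega>) (C' i))\<bar> \<le>
        real m * (\<Sum>i<m. min 1 (measure (M \<omega>) (sym_diff (C i) (C' i))))"
      by (simp add: x_def y_def)
  qed
  also have "\<dots> = real m * (\<Sum>i<m. rho (sym_diff (C i) (C' i)))"
  proof -
    have "expectation (\<lambda>\<omega>. \<Sum>i<m. min 1 (measure (M \<omega>) (sym_diff (C i) (C' i)))) =
        (\<Sum>i<m. rho (sym_diff (C i) (C' i)))"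
      unfolding rho_def by (intro Bochner_Integration.integral_sum rho_integrable sd)
    then show ?thesis by simp
  qed
  finally show ?thesis .
qed

text \<open>The implication between the two disjointness statements in \<open>ring\<close> serves
  both signs: the negative case needs ring families as disjoint as the Borel families they replace.
  Separating the approximants costs no more than the errors already made for the sets D.\<close>

lemma cov_sign_ring_to_borel:
  assumes s: "\<bar>s\<bar> \<le> 1" and u: "lip_incr m u" and v: "lip_incr n v"
    and C: "\<And>i. C i \<in> sets borel" "\<And>i. bounded (C i)"
    and D: "\<And>i. D i \<in> sets borel" "\<And>i. bounded (D i)"
    and ring: "\<And>C' D'. range C' \<subseteq> generated_ring \<Longrightarrow> finite (range C') \<Longrightarrow>
      range D' \<subseteq> generated_ring \<Longrightarrow> finite (range D') \<Longrightarrow>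
      ((\<Union>i. C i) \<inter> (\<Union>i. D i) = {} \<Longrightarrow> (\<Union>i. C' i) \<inter> (\<Union>i. D' i) = {}) \<Longrightarrow>
      0 \<le> s * cov (\<lambda>\<omega>. u (\<lambda>i. measure (M \<omega>) (C' i))) (\<lambda>\<omega>. v (\<lambda>i. measure (M \<omega>) (D' i)))"
  shows "0 \<le> s * cov (\<lambda>\<omega>. u (\<lambda>i. measure (M \<omega>) (C i))) (\<lambda>\<omega>. v (\<lambda>i. measure (M \<omega>) (D i)))"
proof (rule cov_sign_limit[OF unit_rv_lip_incr[OF u C(1)] unit_rv_lip_incr[OF v D(1)] s])
  fix e :: real assume e: "e > 0"
  \<comment> \<open>The errors in units of \<delta>: Lipschitz constant m times m sets with error at
    most 1 + n each, and n times n sets with error 1 each. The final 1 keeps \<open>a\<close>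
    positive.\<close>
  define a where "a = real m * real m * (1 + real n) + real n * real n + 1"
  have a: "a > 0" unfolding a_def by (intro add_nonneg_pos add_nonneg_nonneg) auto
  define \<delta> where "\<delta> = e / a"
  have \<delta>: "\<delta> > 0" using e a by (simp add: \<delta>_def)
  have "\<forall>i. \<exists>R\<in>generated_ring. rho (sym_diff (C i) R) < \<delta>" using rho_ring_approx C \<delta> by blast
  then obtain R where R: "\<And>i. R i \<in> generated_ring" "\<And>i. rho (sym_diff (C i) (R i)) < \<delta>" by metis
  have "\<forall>i. \<exists>R\<in>generated_ring. rho (sym_diff (D i) R) < \<delta>" using rho_ring_approx D \<delta> by blast
  then obtain Q where Q: "\<And>i. Q i \<in> generated_ring" "\<And>i. rho (sym_diff (D i) (Q i)) < \<delta>" by metis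
  \<comment> \<open>Only if the original families are disjoint are the approximants of the D sets
    removed from those of the C sets.\<close>
  define N where "N = (if (\<Union>i. C i) \<inter> (\<Union>i. D i) = {} then \<Union>i<n. Q i else {})"
  \<comment> \<open>Coordinates from m on do not influence u; the empty set there makes the range
    finite.\<close>
  define C' where "C' i = (if i < m then R i - N else {})" for i
  define D' where "D' i = (if i < n then Q i else {})" for i
  have N: "N \<in> generated_ring" using Q(1) by (auto simp: N_def)
  have C'r: "C' i \<in> generated_ring" and D'r: "D' i \<in> generated_ring" for i
    using N Q(1) R(1) by (auto simp: C'_def D'_def)
  have fin: "finite (range C')" "finite (range D')"
  proof -
    have "range C' \<subseteq> insert {} (C' ` {..<m})" "range D' \<subseteq> insert {} (D' ` {..<n})"
      by (auto simp: C'_def D'_def)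
    then show "finite (range C')" "finite (range D')" by (auto intro: finite_subset)
  qed
  note C'b = ring_bdd[OF C'r] and D'b = ring_bdd[OF D'r]
  have rb: "R i \<in> sets borel" "Q i \<in> sets borel" "bounded (R i)" "bounded (Q i)" for i
    using ring_bdd[OF R(1)] ring_bdd[OF Q(1)] by auto
  have rhoC: "rho (sym_diff (C i) (C' i)) \<le> (1 + real n) * \<delta>" if "i < m" for i
  proof -
    \<comment> \<open>A point of \<open>C i\<close> lost to N lies in some \<open>Q j\<close> but,
      by disjointness, not in \<open>D j\<close>, so the approximation error of \<open>D j\<close>
      accounts for it.\<close>
    have sub: "sym_diff (C i) (C' i) \<subseteq> sym_diff (C i) (R i) \<union> (\<Union>j<n. sym_diff (D j) (Q j))"
      using that by (auto simp: C'_def N_def split: if_splits)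
    have sb: "sym_diff (C i) (R i) \<in> sets borel" "sym_diff (D j) (Q j) \<in> sets borel" for j
      using C D rb by auto
    have "rho (sym_diff (C i) (C' i)) \<le> rho (sym_diff (C i) (R i) \<union> (\<Union>j<n. sym_diff (D j) (Q j)))"
    proof (rule rho_mono[OF _ _ _ sub])
      show "sym_diff (C i) (C' i) \<in> sets borel"
        by (intro sets.Un sets.Diff C(1) C'b[THEN conjunct1])
      show "sym_diff (C i) (R i) \<union> (\<Union>j<n. sym_diff (D j) (Q j)) \<in> sets borel"
        by (rule sets.Un[OF sb(1)], rule sets.finite_UN) (use sb(2) in auto)
      have "bounded (\<Union>j<n. D j \<union> Q j)" using D rb by (intro bounded_UN) auto
      then have "bounded ((C i \<union> R i) \<union> (\<Union>j<n. D j \<union> Q j))" using C rb by simp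
      then show "bounded (sym_diff (C i) (R i) \<union> (\<Union>j<n. sym_diff (D j) (Q j)))"
        by (rule bounded_subset) blast
    qed
    also have "\<dots> \<le> rho (sym_diff (C i) (R i)) + rho (\<Union>j<n. sym_diff (D j) (Q j))"
      by (rule rho_Un[OF sb(1)], rule sets.finite_UN) (use sb(2) in auto)
    also have "\<dots> \<le> rho (sym_diff (C i) (R i)) + (\<Sum>j<n. rho (sym_diff (D j) (Q j)))"
      by (intro add_left_mono rho_UN sb)
    also have "\<dots> \<le> \<delta> + (\<Sum>j<n. \<delta>)"
      using R(2) Q(2) by (intro add_mono sum_mono) (auto intro: less_imp_le)
    finally show ?thesis by (simp add: algebra_simps)
  qed
  have "real m * (\<Sum>i<m. rho (sym_diff (C i) (C' i))) \<le> real m * (\<Sum>i<m. (1 + real n) * \<delta>)"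
    using rhoC by (intro mult_left_mono sum_mono) auto
  also have "\<dots> = (real m * real m * (1 + real n)) * \<delta>" by simp
  also have "\<dots> \<le> a * \<delta>" using \<delta> by (intro mult_right_mono) (auto simp: a_def)
  also have "\<dots> = e" using a by (simp add: \<delta>_def)
  finally have eC: "expectation (\<lambda>\<omega>. \<bar>u (\<lambda>i. measure (M \<omega>) (C i)) - u (\<lambda>i. measure (M \<omega>) (C' i))\<bar>) \<le> e"
    using lip_incr_rho[where C = C and C' = C', OF u C] C'b by simp
  have "real n * (\<Sum>i<n. rho (sym_diff (D i) (D' i))) \<le> real n * (\<Sum>i<n. \<delta>)"
    using Q(2) by (intro mult_left_mono sum_mono) (auto simp: D'_def intro: less_imp_le)
  also have "\<dots> = (real n * real n) * \<delta>" by simp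
  also have "\<dots> \<le> a * \<delta>" using \<delta> by (intro mult_right_mono) (auto simp: a_def)
  also have "\<dots> = e" using a by (simp add: \<delta>_def)
  finally have eD: "expectation (\<lambda>\<omega>. \<bar>v (\<lambda>i. measure (M \<omega>) (D i)) - v (\<lambda>i. measure (M \<omega>) (D' i))\<bar>) \<le> e"
    using lip_incr_rho[where C = D and C' = D', OF v D] D'b by simp
  have "(\<Union>i. C' i) \<inter> (\<Union>i. D' i) = {}" if "(\<Union>i. C i) \<inter> (\<Union>i. D i) = {}"
    using that by (auto simp: C'_def D'_def N_def split: if_splits)
  then have "0 \<le> s * cov (\<lambda>\<omega>. u (\<lambda>i. measure (M \<omega>) (C' i))) (\<lambda>\<omega>. v (\<lambda>i. measure (M \<omega>) (D' i)))"
    using C'r D'r fin by (intro ring) auto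
  then show "\<exists>X' Y'. unit_rv X' \<and> unit_rv Y' \<and>
      expectation (\<lambda>\<omega>. \<bar>u (\<lambda>i. measure (M \<omega>) (C i)) - X' \<omega>\<bar>) \<le> e \<and>
      expectation (\<lambda>\<omega>. \<bar>v (\<lambda>i. measure (M \<omega>) (D i)) - Y' \<omega>\<bar>) \<le> e \<and> 0 \<le> s * cov X' Y'"
    using eC eD unit_rv_lip_incr[OF u, of C'] unit_rv_lip_incr[OF v, of D'] C'b D'b by blast
qed

text \<open>The level sets of f and of g are approximated separately, with evaluation sets inside A
  and inside B. Disjointness of A and B thus passes to the sets entering the two vectors.\<close>

lemma cov_sign_borel_to_measure:
  assumes s: "\<bar>s\<bar> \<le> 1" and A: "A \<in> sets borel" and B: "B \<in> sets borel"
    and f: "incr_bdd_M f" "f \<in> borel_measurable (Mmeas_on A)"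
    and g: "incr_bdd_M g" "g \<in> borel_measurable (Mmeas_on B)"
    and vec: "\<And>m u n v C D. lip_incr m u \<Longrightarrow> lip_incr n v \<Longrightarrow>
      (\<And>i. C i \<in> sets borel) \<Longrightarrow> (\<And>i. bounded (C i)) \<Longrightarrow> (\<And>i. C i \<subseteq> A) \<Longrightarrow>
      (\<And>i. D i \<in> sets borel) \<Longrightarrow> (\<And>i. bounded (D i)) \<Longrightarrow> (\<And>i. D i \<subseteq> B) \<Longrightarrow>
      0 \<le> s * cov (\<lambda>\<omega>. u (\<lambda>i. measure (M \<omega>) (C i))) (\<lambda>\<omega>. v (\<lambda>i. measure (M \<omega>) (D i)))"
  shows "0 \<le> s * cov (\<lambda>\<omega>. f (M \<omega>)) (\<lambda>\<omega>. g (M \<omega>))"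
proof -
  have [measurable]: "f \<in> borel_measurable Mmeas" "g \<in> borel_measurable Mmeas"
    using f(1) g(1) by (auto simp: incr_bdd_M_def)
  obtain c where c: "\<And>\<mu>. \<mu> \<in> Mspace \<Longrightarrow> \<bar>f \<mu>\<bar> \<le> c" using f(1) by (auto simp: incr_bdd_M_def)
  obtain d where d: "\<And>\<mu>. \<mu> \<in> Mspace \<Longrightarrow> \<bar>g \<mu>\<bar> \<le> d" using g(1) by (auto simp: incr_bdd_M_def)
  show ?thesis
  proof (rule cov_sign_layers[where C = "max c d", OF _ _ _ _ s])
    show "\<bar>f (M \<omega>)\<bar> \<le> max c d" "\<bar>g (M \<omega>)\<bar> \<le> max c d" if "\<omega> \<in> space P" for \<omega>
      using c d M_Mspace[OF that] by (auto simp: le_max_iff_disj)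
    fix t r
    show "0 \<le> s * cov (\<lambda>\<omega>. if t < f (M \<omega>) then 1 else 0) (\<lambda>\<omega>. if r < g (M \<omega>) then 1 else 0)"
    proof (rule cov_sign_limit[OF _ _ s])
      show "unit_rv (\<lambda>\<omega>. if t < f (M \<omega>) then 1 else 0)" "unit_rv (\<lambda>\<omega>. if r < g (M \<omega>) then 1 else 0)"
        by (auto simp: unit_rv_def)
      fix e :: real assume e: "e > 0"
      obtain m u C where ob1: "lip_incr m u" "\<forall>i. C i \<in> sets borel \<and> bounded (C i) \<and> C i \<subseteq> A" and
        e1: "expectation (\<lambda>\<omega>. \<bar>(if t < f (M \<omega>) then 1 else 0) - u (\<lambda>i. measure (M \<omega>) (C i))\<bar>) < e"
        using level_set_approx[OF f A e, of t] by (elim exE conjE)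
      then have 1: "lip_incr m u" "\<And>i. C i \<in> sets borel" "\<And>i. bounded (C i)" "\<And>i. C i \<subseteq> A" by auto
      obtain n v D where ob2: "lip_incr n v" "\<forall>i. D i \<in> sets borel \<and> bounded (D i) \<and> D i \<subseteq> B" and
        e2: "expectation (\<lambda>\<omega>. \<bar>(if r < g (M \<omega>) then 1 else 0) - v (\<lambda>i. measure (M \<omega>) (D i))\<bar>) < e"
        using level_set_approx[OF g B e, of r] by (elim exE conjE)
      then have 2: "lip_incr n v" "\<And>i. D i \<in> sets borel" "\<And>i. bounded (D i)" "\<And>i. D i \<subseteq> B" by auto
      have "0 \<le> s * cov (\<lambda>\<omega>. u (\<lambda>i. measure (M \<omega>) (C i))) (\<lambda>\<omega>. v (\<lambda>i. measure (M \<omega>) (D i)))"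
        by (rule vec[OF 1(1) 2(1) 1(2,3,4) 2(2,3,4)])
      then show "\<exists>X' Y'. unit_rv X' \<and> unit_rv Y' \<and>
          expectation (\<lambda>\<omega>. \<bar>(if t < f (M \<omega>) then 1 else 0) - X' \<omega>\<bar>) \<le> e \<and>
          expectation (\<lambda>\<omega>. \<bar>(if r < g (M \<omega>) then 1 else 0) - Y' \<omega>\<bar>) \<le> e \<and> 0 \<le> s * cov X' Y'"
        using e1 e2 unit_rv_lip_incr[OF 1(1,2)] unit_rv_lip_incr[OF 2(1,2)]
        by (intro exI[of _ "\<lambda>\<omega>. u (\<lambda>i. measure (M \<omega>) (C i))"]
            exI[of _ "\<lambda>\<omega>. v (\<lambda>i. measure (M \<omega>) (D i))"]) auto
    qed
  qed measurable
qed

definition all_vec :: "('w measure \<Rightarrow> nat \<Rightarrow> (nat \<Rightarrow> 'w \<Rightarrow> real) \<Rightarrow> bool) \<Rightarrow> bool" where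
  "all_vec V \<longleftrightarrow> (\<forall>n\<ge>1. \<forall>B::nat \<Rightarrow> 'a set. (\<forall>i<n. B i \<in> I) \<longrightarrow> disjoint_family_on B {..<n} \<longrightarrow>
     V P n (\<lambda>i \<omega>. measure (M \<omega>) (B i)))"

text \<open>Discarding empty blocks keeps the index sets of disjoint unions disjoint.\<close>

lemma ring_vectors_as_sums:
  assumes "range C \<subseteq> generated_ring" "finite (range C)" "range D \<subseteq> generated_ring" "finite (range D)"
  obtains n :: nat and B S T where "n \<ge> 1" "\<And>i. i < n \<Longrightarrow> B i \<in> I" "disjoint_family_on B {..<n}"
    "\<And>l. S l \<subseteq> {..<n}" "\<And>l. T l \<subseteq> {..<n}"
    "(\<Union>l. C l) \<inter> (\<Union>l. D l) = {} \<Longrightarrow> (\<Union>l. S l) \<inter> (\<Union>l. T l) = {}"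
    "\<And>\<omega> l. \<omega> \<in> space P \<Longrightarrow> measure (M \<omega>) (C l) = (\<Sum>i\<in>S l. measure (M \<omega>) (B i))"
    "\<And>\<omega> l. \<omega> \<in> space P \<Longrightarrow> measure (M \<omega>) (D l) = (\<Sum>i\<in>T l. measure (M \<omega>) (B i))"
proof -
  have F: "finite (range C \<union> range D)" "range C \<union> range D \<subseteq> generated_ring" using assms by auto
  obtain n :: nat and B where "n \<ge> 1" "\<forall>i<n. B i \<in> I" "disjoint_family_on B {..<n}"
    "\<forall>R\<in>range C \<union> range D. R = (\<Union>i\<in>{i. i < n \<and> B i \<noteq> {} \<and> B i \<subseteq> R}. B i)"
    using ring_refinement[OF F] by (elim exE conjE)
  then have B: "n \<ge> 1" "\<And>i. i < n \<Longrightarrow> B i \<in> I" "disjoint_family_on B {..<n}"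
    "\<And>R. R \<in> range C \<union> range D \<Longrightarrow> R = (\<Union>i\<in>{i. i < n \<and> B i \<noteq> {} \<and> B i \<subseteq> R}. B i)"
    by simp_all
  define S where "S R = {i. i < n \<and> B i \<noteq> {} \<and> B i \<subseteq> R}" for R
  have sum: "measure (M \<omega>) R = (\<Sum>i\<in>S R. measure (M \<omega>) (B i))"
    if "R \<in> range C \<union> range D" "\<omega> \<in> space P" for R \<omega>
    using B(4)[OF that(1)]
    by (intro measure_ring_sum[OF M_Mspace[OF that(2)] B(2,3)]) (auto simp: S_def)
  show thesis
  proof (rule that[of n B "\<lambda>l. S (C l)" "\<lambda>l. S (D l)"])
    show "(\<Union>l. S (C l)) \<inter> (\<Union>l. S (D l)) = {}" if "(\<Union>l. C l) \<inter> (\<Union>l. D l) = {}"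
      using that unfolding S_def by blast
  qed (use B sum in \<open>auto simp: S_def\<close>)
qed

text \<open>Vector association is stated for functions of restricted families. As \<open>S l\<close>
  lies in J and \<open>T l\<close> in K, the sums do not notice the restriction.\<close>

lemma cov_lip_incr_sums:
  assumes C: "\<And>\<omega> l. \<omega> \<in> space P \<Longrightarrow> measure (M \<omega>) (C l) = (\<Sum>i\<in>S l. measure (M \<omega>) (B i))"
    and D: "\<And>\<omega> l. \<omega> \<in> space P \<Longrightarrow> measure (M \<omega>) (D l) = (\<Sum>i\<in>T l. measure (M \<omega>) (B i))"
    and ST: "\<And>l. S l \<subseteq> J" "\<And>l. T l \<subseteq> K"
  shows "cov (\<lambda>\<omega>. u (\<lambda>l. measure (M \<omega>) (C l))) (\<lambda>\<omega>. v (\<lambda>l. measure (M \<omega>) (D l))) =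
    cov (\<lambda>\<omega>. u (\<lambda>l. \<Sum>i\<in>S l. (\<lambda>j\<in>J. measure (M \<omega>) (B j)) i))
      (\<lambda>\<omega>. v (\<lambda>l. \<Sum>i\<in>T l. (\<lambda>j\<in>K. measure (M \<omega>) (B j)) i))"
proof -
  have "(\<Sum>i\<in>S l. (\<lambda>j\<in>J. measure (M \<omega>) (B j)) i) = (\<Sum>i\<in>S l. measure (M \<omega>) (B i))" for l \<omega>
    using ST(1) by (intro sum.cong) auto
  moreover have "(\<Sum>i\<in>T l. (\<lambda>j\<in>K. measure (M \<omega>) (B j)) i) = (\<Sum>i\<in>T l. measure (M \<omega>) (B i))" for l \<omega>
    using ST(2) by (intro sum.cong) auto
  ultimately show ?thesis
    unfolding cov_def using C D by (simp cong: Bochner_Integration.integral_cong)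
qed

section \<open>The two equivalences\<close>

lemma NA_rm_iff: "NA_rm P M \<longleftrightarrow> all_vec NA_vec"
proof
  assume NA: "NA_rm P M"
  show "all_vec NA_vec"
    unfolding all_vec_def NA_vec_def
  proof (intro allI impI)
    fix n :: nat and B :: "nat \<Rightarrow> 'a set" and J f g
    assume B: "\<forall>i<n. B i \<in> I" "disjoint_family_on B {..<n}" and J: "J \<subseteq> {..<n}"
      and fg: "incr_bdd_vec J f" "incr_bdd_vec ({..<n} - J) g"
    have BJ: "j \<in> J \<Longrightarrow> B j \<in> I" "j \<in> {..<n} - J \<Longrightarrow> B j \<in> I" for j using B(1) J by auto
    let ?A = "\<Union>j\<in>J. B j" and ?B = "\<Union>j\<in>{..<n} - J. B j"
    have "?A \<in> sets borel" "?B \<in> sets borel"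
      using BJ bdd finite_subset[OF J] by (auto intro!: sets.finite_UN)
    moreover have "?A \<inter> ?B = {}"
    proof -
      have "B i \<inter> B j = {}" if "i \<in> J" "j \<in> {..<n} - J" for i j
        using that J by (intro disjoint_family_onD[OF B(2)]) auto
      then show ?thesis by blast
    qed
    ultimately show "expectation (\<lambda>\<omega>. f (\<lambda>j\<in>J. measure (M \<omega>) (B j)) * g (\<lambda>j\<in>{..<n} - J. measure (M \<omega>) (B j)))
        \<le> expectation (\<lambda>\<omega>. f (\<lambda>j\<in>J. measure (M \<omega>) (B j))) *
          expectation (\<lambda>\<omega>. g (\<lambda>j\<in>{..<n} - J. measure (M \<omega>) (B j)))"
      using NA[unfolded NA_rm_def, rule_format, of ?A ?B "\<lambda>\<mu>. f (\<lambda>j\<in>J. measure \<mu> (B j))"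
          "\<lambda>\<mu>. g (\<lambda>j\<in>{..<n} - J. measure \<mu> (B j))"]
        vec_function_incr_bdd_M(1)[OF fg(1), of B] vec_function_incr_bdd_M(1)[OF fg(2), of B]
        vec_function_incr_bdd_M(2)[OF fg(1), of B ?A] vec_function_incr_bdd_M(2)[OF fg(2), of B ?B] BJ
      by simp
  qed
next
  assume vec: "all_vec NA_vec"
  have ring: "0 \<le> -1 * cov (\<lambda>\<omega>. u (\<lambda>i. measure (M \<omega>) (C i))) (\<lambda>\<omega>. v (\<lambda>i. measure (M \<omega>) (D i)))"
    if uv: "lip_incr m u" "lip_incr k v" and CD: "range C \<subseteq> generated_ring" "finite (range C)"
      "range D \<subseteq> generated_ring" "finite (range D)" "(\<Union>i. C i) \<inter> (\<Union>i. D i) = {}" for m u k v C D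
  proof -
    obtain n :: nat and B S T where B: "n \<ge> 1" "\<And>i. i < n \<Longrightarrow> B i \<in> I" "disjoint_family_on B {..<n}"
      and S: "\<And>l. S l \<subseteq> {..<n}" and T: "\<And>l. T l \<subseteq> {..<n}"
      and disj: "(\<Union>l. S l) \<inter> (\<Union>l. T l) = {}"
      and sums: "\<And>\<omega> l. \<omega> \<in> space P \<Longrightarrow> measure (M \<omega>) (C l) = (\<Sum>i\<in>S l. measure (M \<omega>) (B i))"
        "\<And>\<omega> l. \<omega> \<in> space P \<Longrightarrow> measure (M \<omega>) (D l) = (\<Sum>i\<in>T l. measure (M \<omega>) (B i))"
      using ring_vectors_as_sums[OF CD(1-4)] CD(5) by metis
    \<comment> \<open>J collects the blocks that make up the C sets; disjointness of the index sets
      places all blocks of the D sets in its complement.\<close>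
    define J where "J = (\<Union>l. S l)"
    have J: "J \<subseteq> {..<n}" "\<And>l. S l \<subseteq> J" "\<And>l. T l \<subseteq> {..<n} - J"
      using S T disj unfolding J_def by blast+
    have "NA_vec P n (\<lambda>i \<omega>. measure (M \<omega>) (B i))" using vec B by (auto simp: all_vec_def)
    note vec_ineq = this[unfolded NA_vec_def, rule_format, OF J(1)
        lip_incr_sums_incr_bdd_vec[where S = S, OF uv(1) J(2)]
        lip_incr_sums_incr_bdd_vec[where S = T, OF uv(2) J(3)]]
    have "cov (\<lambda>\<omega>. u (\<lambda>l. measure (M \<omega>) (C l))) (\<lambda>\<omega>. v (\<lambda>l. measure (M \<omega>) (D l))) =
        cov (\<lambda>\<omega>. u (\<lambda>l. \<Sum>i\<in>S l. (\<lambda>j\<in>J. measure (M \<omega>) (B j)) i))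
          (\<lambda>\<omega>. v (\<lambda>l. \<Sum>i\<in>T l. (\<lambda>j\<in>{..<n} - J. measure (M \<omega>) (B j)) i))"
      by (rule cov_lip_incr_sums) (fact sums J(2,3))+
    with vec_ineq show ?thesis by (simp only: cov_def) simp
  qed
  show "NA_rm P M"
    unfolding NA_rm_def
  proof (intro allI impI)
    fix A B :: "'a set" and f g
    assume AB: "A \<in> sets borel" "B \<in> sets borel" "A \<inter> B = {}"
      and f: "incr_bdd_M f" and g: "incr_bdd_M g"
      and fA: "f \<in> borel_measurable (Mmeas_on A)" and gB: "g \<in> borel_measurable (Mmeas_on B)"
    have "0 \<le> -1 * cov (\<lambda>\<omega>. f (M \<omega>)) (\<lambda>\<omega>. g (M \<omega>))"
    proof (rule cov_sign_borel_to_measure[OF _ AB(1,2) f fA g gB])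
      fix m u n v and C D :: "nat \<Rightarrow> 'a set"
      assume uv: "lip_incr m u" "lip_incr n v"
        and C: "\<And>i. C i \<in> sets borel" "\<And>i. bounded (C i)" "\<And>i. C i \<subseteq> A"
        and D: "\<And>i. D i \<in> sets borel" "\<And>i. bounded (D i)" "\<And>i. D i \<subseteq> B"
      have "(\<Union>i. C i) \<inter> (\<Union>i. D i) = {}" using C(3) D(3) AB(3) by blast
      then show "0 \<le> -1 * cov (\<lambda>\<omega>. u (\<lambda>i. measure (M \<omega>) (C i))) (\<lambda>\<omega>. v (\<lambda>i. measure (M \<omega>) (D i)))"
        by (intro cov_sign_ring_to_borel[OF _ uv C(1,2) D(1,2)] ring[OF uv]) auto
    qed simp
    then show "expectation (\<lambda>\<omega>. f (M \<omega>) * g (M \<omega>)) \<le>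
        expectation (\<lambda>\<omega>. f (M \<omega>)) * expectation (\<lambda>\<omega>. g (M \<omega>))"
      by (simp add: cov_def)
  qed
qed

lemma PA_rm_iff: "PA_rm P M \<longleftrightarrow> all_vec PA_vec"
proof
  assume PA: "PA_rm P M"
  show "all_vec PA_vec"
    unfolding all_vec_def PA_vec_def
  proof (intro allI impI)
    fix n :: nat and B :: "nat \<Rightarrow> 'a set" and J f g
    assume B: "\<forall>i<n. B i \<in> I" and J: "J \<subseteq> {..<n}" and fg: "incr_bdd_vec J f" "incr_bdd_vec J g"
    have BJ: "j \<in> J \<Longrightarrow> B j \<in> I" for j using B J by auto
    show "expectation (\<lambda>\<omega>. f (\<lambda>j\<in>J. measure (M \<omega>) (B j)) * g (\<lambda>j\<in>J. measure (M \<omega>) (B j)))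
        \<ge> expectation (\<lambda>\<omega>. f (\<lambda>j\<in>J. measure (M \<omega>) (B j))) *
          expectation (\<lambda>\<omega>. g (\<lambda>j\<in>J. measure (M \<omega>) (B j)))"
      using PA[unfolded PA_rm_def, rule_format, OF vec_function_incr_bdd_M(1)[OF fg(1) BJ]
          vec_function_incr_bdd_M(1)[OF fg(2) BJ]]
      by simp
  qed
next
  assume vec: "all_vec PA_vec"
  have ring: "0 \<le> 1 * cov (\<lambda>\<omega>. u (\<lambda>i. measure (M \<omega>) (C i))) (\<lambda>\<omega>. v (\<lambda>i. measure (M \<omega>) (D i)))"
    if uv: "lip_incr m u" "lip_incr k v" and CD: "range C \<subseteq> generated_ring" "finite (range C)"
      "range D \<subseteq> generated_ring" "finite (range D)" for m u k v C D
  proof -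
    obtain n :: nat and B S T where B: "n \<ge> 1" "\<And>i. i < n \<Longrightarrow> B i \<in> I" "disjoint_family_on B {..<n}"
      and S: "\<And>l. S l \<subseteq> {..<n}" and T: "\<And>l. T l \<subseteq> {..<n}"
      and sums: "\<And>\<omega> l. \<omega> \<in> space P \<Longrightarrow> measure (M \<omega>) (C l) = (\<Sum>i\<in>S l. measure (M \<omega>) (B i))"
        "\<And>\<omega> l. \<omega> \<in> space P \<Longrightarrow> measure (M \<omega>) (D l) = (\<Sum>i\<in>T l. measure (M \<omega>) (B i))"
      using ring_vectors_as_sums[OF CD] by metis
    have "PA_vec P n (\<lambda>i \<omega>. measure (M \<omega>) (B i))" using vec B by (auto simp: all_vec_def)
    \<comment> \<open>With J the whole index set, both functions may use every block.\<close>
    note vec_ineq = this[unfolded PA_vec_def, rule_format, OF order_refl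
        lip_incr_sums_incr_bdd_vec[where S = S, OF uv(1) S]
        lip_incr_sums_incr_bdd_vec[where S = T, OF uv(2) T]]
    have "cov (\<lambda>\<omega>. u (\<lambda>l. measure (M \<omega>) (C l))) (\<lambda>\<omega>. v (\<lambda>l. measure (M \<omega>) (D l))) =
        cov (\<lambda>\<omega>. u (\<lambda>l. \<Sum>i\<in>S l. (\<lambda>j\<in>{..<n}. measure (M \<omega>) (B j)) i))
          (\<lambda>\<omega>. v (\<lambda>l. \<Sum>i\<in>T l. (\<lambda>j\<in>{..<n}. measure (M \<omega>) (B j)) i))"
      by (rule cov_lip_incr_sums) (fact sums S T)+
    with vec_ineq show ?thesis by (simp only: cov_def) simp
  qed
  show "PA_rm P M"
    unfolding PA_rm_def
  proof (intro allI impI)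
    fix f g :: "'a measure \<Rightarrow> real"
    assume f: "incr_bdd_M f" and g: "incr_bdd_M g"
    then have fg: "f \<in> borel_measurable (Mmeas_on UNIV)" "g \<in> borel_measurable (Mmeas_on UNIV)"
      by (auto simp: incr_bdd_M_def Mmeas_def)
    have "0 \<le> 1 * cov (\<lambda>\<omega>. f (M \<omega>)) (\<lambda>\<omega>. g (M \<omega>))"
    \<comment> \<open>Positive association is the case A = B = UNIV, where \<open>Mmeas_on\<close>
      is \<open>Mmeas\<close>.\<close>
    proof (rule cov_sign_borel_to_measure[OF _ _ _ f fg(1) g fg(2)])
      fix m u n v and C D :: "nat \<Rightarrow> 'a set"
      assume uv: "lip_incr m u" "lip_incr n v"
        and C: "\<And>i. C i \<in> sets borel" "\<And>i. bounded (C i)"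
        and D: "\<And>i. D i \<in> sets borel" "\<And>i. bounded (D i)"
      show "0 \<le> 1 * cov (\<lambda>\<omega>. u (\<lambda>i. measure (M \<omega>) (C i))) (\<lambda>\<omega>. v (\<lambda>i. measure (M \<omega>) (D i)))"
        by (intro cov_sign_ring_to_borel[OF _ uv C D] ring[OF uv]) auto
    qed simp_all
    then show "expectation (\<lambda>\<omega>. f (M \<omega>) * g (M \<omega>)) \<ge>
        expectation (\<lambda>\<omega>. f (M \<omega>)) * expectation (\<lambda>\<omega>. g (M \<omega>))"
      by (simp add: cov_def)
  qed
qed

end

theorem theorem4p4:
  fixes P :: "'w measure" and M :: "'w \<Rightarrow> 'a::polish_space measure"
    and I :: "'a set set"
  assumes rm: "random_measure P M"
    and semiring: "semiring_of_sets UNIV I"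
    and cnt: "countable I"
    and bdd: "\<forall>B\<in>I. B \<in> sets borel \<and> bounded B"
    and gen: "sigma_sets UNIV I = sets borel"
    and diss: "dissecting I"
  shows "(NA_rm P M \<longleftrightarrow>
            (\<forall>n\<ge>1. \<forall>B::nat \<Rightarrow> 'a set. (\<forall>i<n. B i \<in> I) \<longrightarrow> disjoint_family_on B {..<n} \<longrightarrow>
               NA_vec P n (\<lambda>i \<omega>. measure (M \<omega>) (B i))))
       \<and> (PA_rm P M \<longleftrightarrow>
            (\<forall>n\<ge>1. \<forall>B::nat \<Rightarrow> 'a set. (\<forall>i<n. B i \<in> I) \<longrightarrow> disjoint_family_on B {..<n} \<longrightarrow>
               PA_vec P n (\<lambda>i \<omega>. measure (M \<omega>) (B i))))"
proof -
  interpret random_measure_semiring I P M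
    using assms
    by (auto simp: random_measure_def random_measure_semiring_def random_measure_semiring_axioms_def
        dissecting_semiring_def dissecting_semiring_axioms_def)
  show ?thesis
    using NA_rm_iff PA_rm_iff unfolding all_vec_def by blast
qed

end
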